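(* Let $K$ be a field and let $\mathcal{P}$ be a thin collection of cells such that: (1) there is no $(i,j)$ such that the three cells with upper-left vertices $(i,j)$, $(i+1,j-1)$ and $(i+2,j-2)$ all belong to $\mathcal{P}$; (2) if $I$ is a maximal inner interval of $\mathcal{P}$ with vertices $(i_1,j_1)$, $(i_1+1,j_1)$, $(i_1,j_2)$ and $(i_1+1,j_2)$, where $j_1<j_2$, then neither the cell with lower-right vertex $(i_1,j_2)$ nor the cell with upper-left vertex $(i_1+1,j_1)$ is contained in $\mathcal{P}$; (3) if $I$ is a maximal inner interval of $\mathcal{P}$ with vertices $(i_1,j_1)$, $(i_1,j_1+1)$, $(i_2,j_1)$ and $(i_2,j_1+1)$, where $i_1<i_2$, then neither the cell with lower-right vertex $(i_1,j_1+1)$ nor the cell with upper-left vertex $(i_2,j_1)$ is contained in $\mathcal{P}$. Then there exists $f\in S=K[x_a\mid a\in V(\mathcal{P})]$ such that $I_{\mathcal{P}}\in\mathcal{C}_f$, that is, $I_{\mathcal{P}}$ is a Knutson ideal.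
   Context: $\mathbb{N}$ is the set of nonnegative integers, and $(i,j)\le (k,l)$ in $\mathbb{N}^2$ means $i\le k$ and $j\le l$. For $a=(i,j)\le b=(k,l)$ put $[a,b]=\{m\in\mathbb{N}^2: a\le m\le b\}$; it is a proper interval if $i<k$ and $j<l$. The vertices of a proper interval are $a$ (lower-left), $b$ (upper-right), $(i,l)$ (upper-left) and $(k,j)$ (lower-right); the last two are its anti-diagonal vertices. A cell is $C=[a,a+(1,1)]$, and $V(C)$ is the set of its four vertices. For a finite collection of cells $\mathcal{P}$, $V(\mathcal{P})=\bigcup_{C\in\mathcal{P}}V(C)$. $\mathcal{P}$ is thin if it does not contain four cells forming a $2\times 2$ square. An inner interval of $\mathcal{P}$ is a proper interval $[a,b]$ with $a,b\in V(\mathcal{P})$ all of whose cells belong to $\mathcal{P}$; it is maximal if it is maximal under inclusion. $I_{\mathcal{P}}\subset S$ is the ideal generated by all binomials $x_ax_b-x_cx_d$, where $[a,b]$ ranges over the inner intervals of $\mathcal{P}$ and $c,d$ are the anti-diagonal vertices of $[a,b]$. Knutson ideals: let $f\in S$ be such that $\operatorname{in}_<(f)$ is a square-free monomial for some monomial order $<$ on $S$. $\mathcal{C}_f$ is the smallest set of ideals of $S$ such that: (1) $(f)\in\mathcal{C}_f$; (2) if $I\in\mathcal{C}_f$ and $J$ is any ideal of $S$, then $I:J\in\mathcal{C}_f$; (3) if $I,J\in\mathcal{C}_f$, then $I+J\in\mathcal{C}_f$ and $I\cap J\in\mathcal{C}_f$. An ideal is a Knutson ideal if it lies in $\mathcal{C}_f$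 for some such $f$. *)

theory Defs
  imports "HOL-Library.Poly_Mapping" "HOL-Algebra.Ideal"
begin

section \<open>Intervals and cells in the lattice of pairs of natural numbers\<close>

text \<open>The componentwise order is written out, so that no order on the type of pairs has to be fixed.\<close>

definition lattice_interval :: "nat \<times> nat \<Rightarrow> nat \<times> nat \<Rightarrow> (nat \<times> nat) set" where
  "lattice_interval a b = {m. fst a \<le> fst m \<and> snd a \<le> snd m \<and> fst m \<le> fst b \<and> snd m \<le> snd b}"

definition proper_interval :: "nat \<times> nat \<Rightarrow> nat \<times> nat \<Rightarrow> bool" where
  "proper_interval a b \<longleftrightarrow> fst a < fst b \<and> snd a < snd b"

definition upper_left :: "nat \<times> nat \<Rightarrow> nat \<times> nat \<Rightarrow> nat \<times> nat" where
  "upper_left a b = (fst a, snd b)"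

definition lower_right :: "nat \<times> nat \<Rightarrow> nat \<times> nat \<Rightarrow> nat \<times> nat" where
  "lower_right a b = (fst b, snd a)"

definition interval_vertices :: "nat \<times> nat \<Rightarrow> nat \<times> nat \<Rightarrow> (nat \<times> nat) set" where
  "interval_vertices a b = {a, b, upper_left a b, lower_right a b}"

definition cell_top :: "nat \<times> nat \<Rightarrow> nat \<times> nat" where
  "cell_top a = (fst a + 1, snd a + 1)"

definition cell :: "nat \<times> nat \<Rightarrow> (nat \<times> nat) set" where
  "cell a = lattice_interval a (cell_top a)"

text \<open>
  A collection of cells is a finite nonempty set of cells. For the empty collection the ring of
  polynomials is the field itself and the ideal of inner minors is zero, while an admissible
  \<open>f\<close> is a unit and the whole ring is its only Knutson ideal; that case has to be left out.
\<close>

definition cell_collection :: "(nat \<times> nat) set set \<Rightarrow> bool" where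
  "cell_collection P \<longleftrightarrow> finite P \<and> P \<noteq> {} \<and> P \<subseteq> range cell"

definition vertex_set :: "(nat \<times> nat) set set \<Rightarrow> (nat \<times> nat) set" where
  "vertex_set P = (\<Union>a\<in>{a. cell a \<in> P}. interval_vertices a (cell_top a))"

definition thin :: "(nat \<times> nat) set set \<Rightarrow> bool" where
  "thin P \<longleftrightarrow>
    \<not> (\<exists>i j. cell (i, j) \<in> P \<and> cell (i + 1, j) \<in> P \<and> cell (i, j + 1) \<in> P \<and> cell (i + 1, j + 1) \<in> P)"

text \<open>
  The upper-left vertex of a cell has positive second coordinate. Hence truncated subtraction in the
  second coordinate, as in \<open>(i + 1, j - 1)\<close>, never produces a spurious upper-left vertex.
\<close>

definition has_cell_upper_left :: "(nat \<times> nat) set set \<Rightarrow> nat \<times> nat \<Rightarrow> bool" where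
  "has_cell_upper_left P v \<longleftrightarrow> (\<exists>a. cell a \<in> P \<and> upper_left a (cell_top a) = v)"

definition has_cell_lower_right :: "(nat \<times> nat) set set \<Rightarrow> nat \<times> nat \<Rightarrow> bool" where
  "has_cell_lower_right P v \<longleftrightarrow> (\<exists>a. cell a \<in> P \<and> lower_right a (cell_top a) = v)"

definition inner_interval :: "(nat \<times> nat) set set \<Rightarrow> nat \<times> nat \<Rightarrow> nat \<times> nat \<Rightarrow> bool" where
  "inner_interval P a b \<longleftrightarrow>
    proper_interval a b \<and> a \<in> vertex_set P \<and> b \<in> vertex_set P \<and>
    (\<forall>c. cell c \<subseteq> lattice_interval a b \<longrightarrow> cell c \<in> P)"

definition maximal_inner_interval :: "(nat \<times> nat) set set \<Rightarrow> nat \<times> nat \<Rightarrow> nat \<times> nat \<Rightarrow> bool" where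
  "maximal_inner_interval P a b \<longleftrightarrow>
    inner_interval P a b \<and>
    \<not> (\<exists>c d. inner_interval P c d \<and> lattice_interval a b \<subset> lattice_interval c d)"


section \<open>Polynomials with variables in a given set\<close>

text \<open>
  A monomial is its exponent vector, a finitely supported map from the variables to the natural
  numbers, and a polynomial is a finitely supported map from the monomials to the coefficients.
  Addition of exponent vectors is multiplication of monomials and \<open>0\<close> is the monomial one.
\<close>

type_synonym 'v monom = "'v \<Rightarrow>\<^sub>0 nat"

type_synonym ('v, 'k) mvpoly = "'v monom \<Rightarrow>\<^sub>0 'k"

definition monoms_in :: "'v set \<Rightarrow> 'v monom set" where
  "monoms_in V = {m. Poly_Mapping.keys m \<subseteq> V}"

definition poly_ring :: "'v set \<Rightarrow> ('v, 'k::comm_ring_1) mvpoly ring" where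
  "poly_ring V =
    \<lparr>carrier = {p. Poly_Mapping.keys p \<subseteq> monoms_in V}, mult = (*), one = 1, zero = 0, add = (+)\<rparr>"

definition mvar :: "'v \<Rightarrow> ('v, 'k::comm_ring_1) mvpoly" where
  "mvar v = Poly_Mapping.single (Poly_Mapping.single v 1) 1"

lemma poly_ring_simps [simp]:
  "x \<otimes>\<^bsub>poly_ring V\<^esub> y = x * y" "x \<oplus>\<^bsub>poly_ring V\<^esub> y = x + y"
  "\<one>\<^bsub>poly_ring V\<^esub> = 1" "\<zero>\<^bsub>poly_ring V\<^esub> = 0"
  by (simp_all add: poly_ring_def)

lemma carrier_poly_ring:
  "p \<in> carrier (poly_ring V) \<longleftrightarrow> (\<forall>m\<in>Poly_Mapping.keys p. Poly_Mapping.keys m \<subseteq> V)"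
  by (auto simp: poly_ring_def monoms_in_def)

lemma cring_poly_ring: "cring (poly_ring V :: ('v, 'k::comm_ring_1) mvpoly ring)"
proof (rule cringI)
  show "abelian_group (poly_ring V :: ('v, 'k) mvpoly ring)"
  proof (rule abelian_groupI)
    fix x y :: "('v, 'k) mvpoly"
    assume x: "x \<in> carrier (poly_ring V)"
    show "\<exists>y\<in>carrier (poly_ring V). y \<oplus>\<^bsub>poly_ring V\<^esub> x = \<zero>\<^bsub>poly_ring V\<^esub>"
      using x by (intro bexI[of _ "- x"]) (auto simp: carrier_poly_ring)
    assume "y \<in> carrier (poly_ring V)"
    with x show "x \<oplus>\<^bsub>poly_ring V\<^esub> y \<in> carrier (poly_ring V)"
      using Poly_Mapping.keys_add[of x y] by (fastforce simp: carrier_poly_ring)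
  qed (auto simp: carrier_poly_ring algebra_simps)
  show "comm_monoid (poly_ring V :: ('v, 'k) mvpoly ring)"
  proof (rule comm_monoidI)
    fix x y :: "('v, 'k) mvpoly"
    assume x: "x \<in> carrier (poly_ring V)" and y: "y \<in> carrier (poly_ring V)"
    have "Poly_Mapping.keys m \<subseteq> V" if m: "m \<in> Poly_Mapping.keys (x * y)" for m
    proof -
      obtain s t where "m = s + t" "s \<in> Poly_Mapping.keys x" "t \<in> Poly_Mapping.keys y"
        using m Poly_Mapping.keys_mult[of x y] by blast
      then show ?thesis
        using x y Poly_Mapping.keys_add[of s t] unfolding carrier_poly_ring by blast
    qed
    then show "x \<otimes>\<^bsub>poly_ring V\<^esub> y \<in> carrier (poly_ring V)"
      by (simp add: carrier_poly_ring)
  qed (auto simp: carrier_poly_ring algebra_simps)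
qed (simp add: algebra_simps)

definition polyomino_ideal :: "(nat \<times> nat) set set \<Rightarrow> (nat \<times> nat, 'k::field) mvpoly set" where
  "polyomino_ideal P =
    Idl\<^bsub>poly_ring (vertex_set P)\<^esub>
      {mvar a * mvar b - mvar (upper_left a b) * mvar (lower_right a b) | a b. inner_interval P a b}"


section \<open>Monomial orders and Knutson ideals\<close>

text \<open>
  For finite \<open>V\<close> such an order is automatically a well-order. \<open>(m, n) \<in> r\<close> means that \<open>m\<close> is below or equal to \<open>n\<close>.
\<close>

definition monomial_order :: "'v set \<Rightarrow> 'v monom rel \<Rightarrow> bool" where
  "monomial_order V r \<longleftrightarrow>
    linear_order_on (monoms_in V) r \<and>
    (\<forall>m\<in>monoms_in V. (0, m) \<in> r) \<and>
    (\<forall>m n t. (m, n) \<in> r \<and> t \<in> monoms_in V \<longrightarrow> (m + t, n + t) \<in> r)"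

text \<open>The zero polynomial has no initial monomial.\<close>

definition is_initial_monomial :: "'v monom rel \<Rightarrow> ('v, 'k::zero) mvpoly \<Rightarrow> 'v monom \<Rightarrow> bool" where
  "is_initial_monomial r f m \<longleftrightarrow>
    m \<in> Poly_Mapping.keys f \<and> (\<forall>n\<in>Poly_Mapping.keys f. (n, m) \<in> r)"

definition squarefree_monomial :: "'v monom \<Rightarrow> bool" where
  "squarefree_monomial m \<longleftrightarrow> (\<forall>v. Poly_Mapping.lookup m v \<le> 1)"

definition has_squarefree_initial_monomial :: "'v set \<Rightarrow> ('v, 'k::zero) mvpoly \<Rightarrow> bool" where
  "has_squarefree_initial_monomial V f \<longleftrightarrow>
    (\<exists>r m. monomial_order V r \<and> is_initial_monomial r f m \<and> squarefree_monomial m)"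

definition ideal_quotient :: "('a, 'm) ring_scheme \<Rightarrow> 'a set \<Rightarrow> 'a set \<Rightarrow> 'a set" where
  "ideal_quotient R I J = {x \<in> carrier R. \<forall>y\<in>J. x \<otimes>\<^bsub>R\<^esub> y \<in> I}"

inductive_set knutson_class :: "('a, 'm) ring_scheme \<Rightarrow> 'a \<Rightarrow> 'a set set"
  for R (structure) and f where
  principal: "PIdl f \<in> knutson_class R f"
| quotient: "I \<in> knutson_class R f \<Longrightarrow> ideal J R \<Longrightarrow> ideal_quotient R I J \<in> knutson_class R f"
| sum: "I \<in> knutson_class R f \<Longrightarrow> J \<in> knutson_class R f \<Longrightarrow> I <+> J \<in> knutson_class R f"
| inter: "I \<in> knutson_class R f \<Longrightarrow> J \<in> knutson_class R f \<Longrightarrow> I \<inter> J \<in> knutson_class R f"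

end

theory Submission
  imports Defs "HOL-Library.Product_Lexorder"
begin

text \<open>
  The maximal inner intervals of a thin collection are strips of width one, and the ideal is the sum of
  the ideals \<open>Q\<close> of the \<open>2\<close>-minors of these strips. The polynomial \<open>f\<close> is the product of the minors of
  the cells with no anti-diagonal neighbour and of the determinants of the \<open>3 \<times> 3\<close> blocks around the
  remaining pairs of anti-diagonal neighbours. By condition (1) the anti-diagonal terms of the factors
  involve disjoint sets of variables, so their product is a square-free initial monomial. Let \<open>A\<close> be
  generated by the factors of \<open>f\<close> that lie in \<open>Q\<close>. Conditions (2) and (3) force one of the other two
  cells of each block that meets the strip to be a factor of \<open>f\<close> in \<open>Q\<close>, so by the Desnanot--Jacobi
  identity \<open>A\<close> contains a multiple of every cell minor of the strip. Hence \<open>u Q \<subseteq> A \<subseteq> Q\<close> for some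
  \<open>u \<notin> Q\<close>, and \<open>Q = A : u\<close> because \<open>Q\<close> is the kernel of a map to a domain.
\<close>

text \<open>\<open>A\<close> has at most one generator per factor of \<open>f\<close>, so it is in
  general much smaller than \<open>Q\<close>, which needs all minors of the strip. It has the right
  generic behaviour, though: once the entries of the first row are invertible, proportionality of
  adjacent columns forces proportionality of all columns. The element \<open>u\<close> records
  exactly what has to be inverted: the variables of the first row, and for each cell of the strip
  that is not itself a factor the minor of its anti-diagonal partner. Such a partner has a vertex
  off the strip, whose variable occurs in only one term of its minor; hence the minor does not
  vanish on the generic matrix of rank one and \<open>u\<close> is outside \<open>Q\<close>. That
  \<open>A\<close> is available at all comes from \<open>(g h) : (h) = (g)\<close>, which puts the
  ideal of every factor into the class. Conditions (2) and (3) act twice. They keep a cell with an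
  anti-diagonal neighbour away from the end of the strip on the side of the block, so that the block
  meets the strip in two full lines and its determinant lies in \<open>Q\<close> by Laplace
  expansion. They also prevent the third cell of the block from having anti-diagonal neighbours of
  its own, so that its minor is a factor of \<open>f\<close>.\<close>

section \<open>Polynomials as finitely supported maps\<close>

lemma sum_single_lookup:
  fixes p :: "'a \<Rightarrow>\<^sub>0 'b::comm_monoid_add"
  assumes "finite S" "Poly_Mapping.keys p \<subseteq> S"
  shows "(\<Sum>m\<in>S. Poly_Mapping.single m (Poly_Mapping.lookup p m)) = p"
proof (rule poly_mapping_eqI)
  fix k
  have "Poly_Mapping.lookup (\<Sum>m\<in>S. Poly_Mapping.single m (Poly_Mapping.lookup p m)) k = (\<Sum>m\<in>S. if m = k then Poly_Mapping.lookup p m else 0)"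
    by (simp add: lookup_sum lookup_single when_def)
  also have "\<dots> = Poly_Mapping.lookup p k"
    using assms by (auto simp: in_keys_iff)
  finally show "Poly_Mapping.lookup (\<Sum>m\<in>S. Poly_Mapping.single m (Poly_Mapping.lookup p m)) k = Poly_Mapping.lookup p k" .
qed

lemma single_eq_0_iff [simp]: "Poly_Mapping.single m c = 0 \<longleftrightarrow> c = 0"
  by (metis lookup_single_eq lookup_zero single_zero)

text \<open>Linear pushforward along a map of exponents; coefficients of monomials with the same
  image are added. Additivity of \<open>h\<close> is left to \<open>monom_map_mult\<close>, because
  \<open>kernel_le_minors_ideal\<close> also pushes forward along a choice of representatives, which
  is not a homomorphism.\<close>

definition monom_map :: "('a \<Rightarrow> 'b) \<Rightarrow> ('a \<Rightarrow>\<^sub>0 'k::comm_monoid_add) \<Rightarrow> 'b \<Rightarrow>\<^sub>0 'k" where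
  "monom_map h p = (\<Sum>m\<in>Poly_Mapping.keys p. Poly_Mapping.single (h m) (Poly_Mapping.lookup p m))"

lemma monom_map_superset:
  assumes "finite S" "Poly_Mapping.keys p \<subseteq> S"
  shows "monom_map h p = (\<Sum>m\<in>S. Poly_Mapping.single (h m) (Poly_Mapping.lookup p m))"
  unfolding monom_map_def using assms
  by (intro sum.mono_neutral_left) (auto simp: in_keys_iff)

lemma monom_map_add: "monom_map h (p + q) = monom_map h p + monom_map h q"
proof -
  let ?S = "Poly_Mapping.keys p \<union> Poly_Mapping.keys q"
  have "Poly_Mapping.keys (p + q) \<subseteq> ?S"
    by (rule Poly_Mapping.keys_add)
  then show ?thesis
    by (simp add: monom_map_superset[of ?S] lookup_add single_add sum.distrib)
qed

lemma monom_map_single [simp]: "monom_map h (Poly_Mapping.single m c) = Poly_Mapping.single (h m) c"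
  by (simp add: monom_map_def)

lemma monom_map_0 [simp]: "monom_map h 0 = 0"
  by (simp add: monom_map_def)

lemma monom_map_sum: "monom_map h (\<Sum>i\<in>S. p i) = (\<Sum>i\<in>S. monom_map h (p i))"
  by (induction S rule: infinite_finite_induct) (simp_all add: monom_map_add)

lemma monom_map_diff:
  fixes p q :: "'a \<Rightarrow>\<^sub>0 'k::ab_group_add"
  shows "monom_map h (p - q) = monom_map h p - monom_map h q"
  using monom_map_add[of h "p - q" q] by simp

lemma monom_map_monom_map: "monom_map g (monom_map h p) = monom_map (g \<circ> h) p"
  unfolding monom_map_def[of h] monom_map_def[of "g \<circ> h"] by (simp add: monom_map_sum)

lemma monom_map_mult:
  fixes p q :: "'a::monoid_add \<Rightarrow>\<^sub>0 'k::semiring_0"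
  assumes "\<And>m n. h (m + n) = h m + h n"
  shows "monom_map h (p * q) = monom_map h p * monom_map h q"
proof -
  have "p * q = (\<Sum>m\<in>Poly_Mapping.keys p. Poly_Mapping.single m (Poly_Mapping.lookup p m)) * (\<Sum>n\<in>Poly_Mapping.keys q. Poly_Mapping.single n (Poly_Mapping.lookup q n))"
    by (simp add: sum_single_lookup)
  also have "\<dots> = (\<Sum>m\<in>Poly_Mapping.keys p. \<Sum>n\<in>Poly_Mapping.keys q. Poly_Mapping.single (m + n) (Poly_Mapping.lookup p m * Poly_Mapping.lookup q n))"
    by (simp add: sum_product mult_single)
  finally have "monom_map h (p * q) =
      (\<Sum>m\<in>Poly_Mapping.keys p. \<Sum>n\<in>Poly_Mapping.keys q. Poly_Mapping.single (h m + h n) (Poly_Mapping.lookup p m * Poly_Mapping.lookup q n))"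
    by (simp add: monom_map_sum assms)
  also have "\<dots> = monom_map h p * monom_map h q"
    by (simp add: monom_map_def sum_product mult_single)
  finally show ?thesis .
qed


section \<open>Ideals of a polynomial ring\<close>

lemma ring_poly_ring: "ring (poly_ring V :: ('v, 'k::comm_ring_1) mvpoly ring)"
  using cring_poly_ring by (rule cring.axioms)

lemma carrier_mult:
  "p \<in> carrier (poly_ring V) \<Longrightarrow> q \<in> carrier (poly_ring V) \<Longrightarrow> p * q \<in> carrier (poly_ring V)"
  using monoid.m_closed[OF ring.is_monoid[OF ring_poly_ring, of V], of p q] by simp

lemma carrier_add:
  "p \<in> carrier (poly_ring V) \<Longrightarrow> q \<in> carrier (poly_ring V) \<Longrightarrow> p + q \<in> carrier (poly_ring V)"
  using ring.ring_simprules(1)[OF ring_poly_ring, of p V q] by simp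

lemma carrier_uminus: "p \<in> carrier (poly_ring V) \<Longrightarrow> - p \<in> carrier (poly_ring V)"
  by (auto simp: carrier_poly_ring)

lemma carrier_diff:
  "p \<in> carrier (poly_ring V) \<Longrightarrow> q \<in> carrier (poly_ring V) \<Longrightarrow> p - q \<in> carrier (poly_ring V)"
  using carrier_add[of p V "- q"] carrier_uminus[of q V] by simp

lemma carrier_0: "0 \<in> carrier (poly_ring V)"
  by (simp add: carrier_poly_ring)

lemma carrier_1: "1 \<in> carrier (poly_ring V)"
  by (simp add: carrier_poly_ring)

lemma carrier_single: "m \<in> monoms_in V \<Longrightarrow> Poly_Mapping.single m c \<in> carrier (poly_ring V)"
  by (auto simp: carrier_poly_ring monoms_in_def split: if_splits)

lemma carrier_mvar: "v \<in> V \<Longrightarrow> mvar v \<in> carrier (poly_ring V)"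
  unfolding mvar_def by (rule carrier_single) (simp add: monoms_in_def)

lemma carrier_prod:
  "(\<And>i. i \<in> S \<Longrightarrow> p i \<in> carrier (poly_ring V)) \<Longrightarrow> prod p S \<in> carrier (poly_ring V)"
  by (induction S rule: infinite_finite_induct) (auto intro: carrier_mult carrier_1)

lemmas carrier_intros =
  carrier_add carrier_mult carrier_diff carrier_uminus carrier_0 carrier_1 carrier_mvar carrier_prod

lemma ideal_carrier: "ideal I (poly_ring V) \<Longrightarrow> p \<in> I \<Longrightarrow> p \<in> carrier (poly_ring V)"
  by (rule ideal.Icarr)

lemma ideal_add: "ideal I (poly_ring V) \<Longrightarrow> p \<in> I \<Longrightarrow> q \<in> I \<Longrightarrow> p + q \<in> I"
  using additive_subgroup.a_closed[of I "poly_ring V" p q]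
  by (simp add: ideal.axioms(1))

lemma ideal_0: "ideal I (poly_ring V) \<Longrightarrow> 0 \<in> I"
  using additive_subgroup.zero_closed[of I "poly_ring V"] by (simp add: ideal.axioms(1))

lemma ideal_mult:
  "ideal I (poly_ring V) \<Longrightarrow> p \<in> I \<Longrightarrow> q \<in> carrier (poly_ring V) \<Longrightarrow> q * p \<in> I"
  using ideal.I_l_closed[of I "poly_ring V" p q] by simp

lemma ideal_uminus:
  fixes I :: "('v, 'k::comm_ring_1) mvpoly set"
  shows "ideal I (poly_ring V) \<Longrightarrow> p \<in> I \<Longrightarrow> - p \<in> I"
  using ideal_mult[of I V p "- 1"] by (simp add: carrier_intros)

lemma ideal_diff:
  fixes I :: "('v, 'k::comm_ring_1) mvpoly set"
  shows "ideal I (poly_ring V) \<Longrightarrow> p \<in> I \<Longrightarrow> q \<in> I \<Longrightarrow> p - q \<in> I"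
  using ideal_add[of I V p "- q"] ideal_uminus[of I V q] by simp

lemma ideal_sum:
  "ideal I (poly_ring V) \<Longrightarrow> (\<And>i. i \<in> S \<Longrightarrow> p i \<in> I) \<Longrightarrow> sum p S \<in> I"
  by (induction S rule: infinite_finite_induct) (auto intro: ideal_add ideal_0)

lemma ideal_poly_ringI:
  fixes I :: "('v, 'k::comm_ring_1) mvpoly set"
  assumes "I \<subseteq> carrier (poly_ring V)" "0 \<in> I"
    and add: "\<And>p q. p \<in> I \<Longrightarrow> q \<in> I \<Longrightarrow> p + q \<in> I"
    and mult: "\<And>p q. p \<in> I \<Longrightarrow> q \<in> carrier (poly_ring V) \<Longrightarrow> q * p \<in> I"
  shows "ideal I (poly_ring V)"
proof (rule idealI[OF ring_poly_ring])
  show "subgroup I (add_monoid (poly_ring V))"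
  proof (rule subgroup.intro)
    fix p
    assume "p \<in> I"
    have "- p \<in> I"
      using mult[OF \<open>p \<in> I\<close>, of "- 1"] by (simp add: carrier_intros)
    moreover have "inv\<^bsub>add_monoid (poly_ring V)\<^esub> p = - p"
      using assms(1) \<open>p \<in> I\<close> \<open>- p \<in> I\<close>
      by (intro comm_monoid.comm_inv_char abelian_monoid.a_comm_monoid
          abelian_group.axioms ring.is_abelian_group ring_poly_ring) auto
    ultimately show "inv\<^bsub>add_monoid (poly_ring V)\<^esub> p \<in> I"
      by simp
  qed (use assms in auto)
qed (use mult in \<open>auto simp: mult.commute\<close>)

lemma ideal_genideal:
  "S \<subseteq> carrier (poly_ring V) \<Longrightarrow> ideal (Idl\<^bsub>poly_ring V\<^esub> S) (poly_ring V)"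
  by (rule ring.genideal_ideal[OF ring_poly_ring])

lemma genideal_le_iff:
  assumes "S \<subseteq> carrier (poly_ring V)" "ideal I (poly_ring V)"
  shows "Idl\<^bsub>poly_ring V\<^esub> S \<subseteq> I \<longleftrightarrow> S \<subseteq> I"
  using ring.genideal_minimal[OF ring_poly_ring assms(2), of S]
    ring.genideal_self[OF ring_poly_ring assms(1)] by blast

text \<open>The elements that \<open>u\<close> multiplies into \<open>I\<close> form an ideal, so
  generators suffice.\<close>

lemma genideal_mult_le:
  fixes u :: "('v, 'k::comm_ring_1) mvpoly"
  assumes S: "S \<subseteq> carrier (poly_ring V)" and I: "ideal I (poly_ring V)"
    and u: "\<And>s. s \<in> S \<Longrightarrow> u * s \<in> I" and x: "x \<in> Idl\<^bsub>poly_ring V\<^esub> S"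
  shows "u * x \<in> I"
proof -
  have "ideal {x \<in> carrier (poly_ring V). u * x \<in> I} (poly_ring V)"
    using ideal_0[OF I] ideal_add[OF I] ideal_mult[OF I]
    by (intro ideal_poly_ringI) (auto simp: carrier_intros distrib_left mult.left_commute)
  then have "Idl\<^bsub>poly_ring V\<^esub> S \<subseteq> {x \<in> carrier (poly_ring V). u * x \<in> I}"
    using genideal_le_iff[OF S] S u by blast
  then show ?thesis
    using x by blast
qed

lemma cgenideal_poly_ring:
  "PIdl\<^bsub>poly_ring V\<^esub> g = {x * g | x. x \<in> carrier (poly_ring V)}"
  by (simp add: cgenideal_def)

lemma genideal_singleton:
  "g \<in> carrier (poly_ring V) \<Longrightarrow> Idl\<^bsub>poly_ring V\<^esub> {g} = PIdl\<^bsub>poly_ring V\<^esub> g"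
  using cring.cgenideal_eq_genideal[OF cring_poly_ring] by blast

section \<open>Producing members of the Knutson class by quotients and sums\<close>

lemma ideal_quotient_eqI:
  assumes u: "u \<in> carrier (poly_ring V)" and Q: "ideal Q (poly_ring V)"
    and A: "ideal A (poly_ring V)"
    and mult: "\<And>x. x \<in> Q \<Longrightarrow> u * x \<in> A"
    and cancel: "\<And>x. x \<in> carrier (poly_ring V) \<Longrightarrow> x * u \<in> A \<Longrightarrow> x \<in> Q"
  shows "ideal_quotient (poly_ring V) A (PIdl\<^bsub>poly_ring V\<^esub> u) = Q"
proof -
  have "x \<in> Q" if "x \<in> carrier (poly_ring V)" "\<forall>y\<in>PIdl\<^bsub>poly_ring V\<^esub> u. x * y \<in> A" for x
  proof -
    have "1 * u \<in> PIdl\<^bsub>poly_ring V\<^esub> u"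
      unfolding cgenideal_poly_ring using carrier_1 by blast
    then show ?thesis
      using that by (intro cancel) auto
  qed
  moreover have "x * y \<in> A" if x: "x \<in> Q" and y: "y \<in> PIdl\<^bsub>poly_ring V\<^esub> u" for x y
  proof -
    obtain z where z: "y = z * u" "z \<in> carrier (poly_ring V)"
      using y unfolding cgenideal_poly_ring by blast
    have "x * y = z * (u * x)"
      by (simp add: z mult_ac)
    then show ?thesis
      using ideal_mult[OF A mult[OF x] z(2)] by simp
  qed
  ultimately show ?thesis
    using ideal_carrier[OF Q] by (auto simp: ideal_quotient_def)
qed

text \<open>Uniting generating sets adds the ideals. The family must be nonempty: every member of
  the class contains \<open>f\<close>, so for nonzero \<open>f\<close> the zero ideal, which an
  empty union would generate, is not a member.\<close>

lemma knutson_class_genideal_Union: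
  assumes "finite M" "M \<noteq> {}"
    and "\<And>S. S \<in> M \<Longrightarrow> S \<subseteq> carrier (poly_ring V)"
    and "\<And>S. S \<in> M \<Longrightarrow> Idl\<^bsub>poly_ring V\<^esub> S \<in> knutson_class (poly_ring V) f"
  shows "Idl\<^bsub>poly_ring V\<^esub> (\<Union>M) \<in> knutson_class (poly_ring V) f"
  using assms
proof (induction M rule: finite_ne_induct)
  case (insert S M)
  interpret R: ring "poly_ring V"
    by (rule ring_poly_ring)
  let ?I = "Idl\<^bsub>poly_ring V\<^esub> S" and ?J = "Idl\<^bsub>poly_ring V\<^esub> (\<Union>M)"
  have S: "S \<subseteq> carrier (poly_ring V)" and M: "\<Union>M \<subseteq> carrier (poly_ring V)"
    using insert.prems by auto
  have I: "ideal ?I (poly_ring V)" and J: "ideal ?J (poly_ring V)"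
    using S M by (auto intro: ideal_genideal)
  have sub: "S \<subseteq> ?I" "\<Union>M \<subseteq> ?J"
    using R.genideal_self[OF S] R.genideal_self[OF M] .
  have carr: "?I \<union> ?J \<subseteq> carrier (poly_ring V)"
    using ideal_carrier[OF I] ideal_carrier[OF J] by blast
  have "\<Union>(insert S M) \<subseteq> Idl\<^bsub>poly_ring V\<^esub> (?I \<union> ?J)"
    using R.genideal_self[OF carr] sub by auto
  then have "Idl\<^bsub>poly_ring V\<^esub> (\<Union>(insert S M)) \<subseteq> Idl\<^bsub>poly_ring V\<^esub> (?I \<union> ?J)"
    using S M carr by (subst genideal_le_iff) (auto intro: ideal_genideal)
  moreover have "Idl\<^bsub>poly_ring V\<^esub> (?I \<union> ?J) \<subseteq> Idl\<^bsub>poly_ring V\<^esub> (\<Union>(insert S M))"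
  proof -
    have "ideal (Idl\<^bsub>poly_ring V\<^esub> (\<Union>(insert S M))) (poly_ring V)"
      using S M by (intro ideal_genideal) auto
    moreover have "S \<union> \<Union>M \<subseteq> Idl\<^bsub>poly_ring V\<^esub> (\<Union>(insert S M))"
      using R.genideal_self[of "\<Union>(insert S M)"] S M by auto
    ultimately show ?thesis
      using S M carr by (simp add: genideal_le_iff)
  qed
  ultimately have "Idl\<^bsub>poly_ring V\<^esub> (\<Union>(insert S M)) = ?I <+>\<^bsub>poly_ring V\<^esub> ?J"
    using R.union_genideal[OF I J] by simp
  then show ?case
    using insert by (auto intro: knutson_class.sum)
qed simp

text \<open>This is \<open>(g h) : (h) = (g)\<close>, by cancellation of \<open>h\<close>. The
  linear order on the variables makes the exponent vectors linearly ordered, and this is what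
  excludes zero divisors.\<close>

lemma knutson_class_factor:
  fixes g h :: "('v::linorder, 'k::field) mvpoly"
  assumes g: "g \<in> carrier (poly_ring V)" and h: "h \<in> carrier (poly_ring V)" and "h \<noteq> 0"
  shows "Idl\<^bsub>poly_ring V\<^esub> {g} \<in> knutson_class (poly_ring V) (g * h)"
proof -
  interpret R: cring "poly_ring V"
    by (rule cring_poly_ring)
  have "ideal_quotient (poly_ring V) (PIdl\<^bsub>poly_ring V\<^esub> (g * h)) (PIdl\<^bsub>poly_ring V\<^esub> h) = PIdl\<^bsub>poly_ring V\<^esub> g"
  proof (rule ideal_quotient_eqI)
    fix x
    assume "x \<in> PIdl\<^bsub>poly_ring V\<^esub> g"
    then show "h * x \<in> PIdl\<^bsub>poly_ring V\<^esub> (g * h)"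
      unfolding cgenideal_poly_ring by (auto simp: mult_ac)
  next
    fix x
    assume "x \<in> carrier (poly_ring V)" "x * h \<in> PIdl\<^bsub>poly_ring V\<^esub> (g * h)"
    then obtain z where "x * h = z * g * h" "z \<in> carrier (poly_ring V)"
      unfolding cgenideal_poly_ring by (auto simp: mult.assoc)
    then show "x \<in> PIdl\<^bsub>poly_ring V\<^esub> g"
      using \<open>h \<noteq> 0\<close> unfolding cgenideal_poly_ring by auto
  qed (use g h in \<open>auto intro: R.cgenideal_ideal carrier_mult\<close>)
  moreover have "ideal (PIdl\<^bsub>poly_ring V\<^esub> h) (poly_ring V)"
    by (rule R.cgenideal_ideal[OF h])
  ultimately show ?thesis
    using knutson_class.quotient[OF knutson_class.principal] genideal_singleton[OF g] by metis
qed

section \<open>Two-row matrices of variables\<close>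

definition minor :: "'v \<Rightarrow> 'v \<Rightarrow> 'v \<Rightarrow> 'v \<Rightarrow> ('v, 'k::comm_ring_1) mvpoly" where
  "minor a b c d = mvar a * mvar b - mvar c * mvar d"

lemma mvar_mult_mvar: "mvar a * mvar b = Poly_Mapping.single (Poly_Mapping.single a 1 + Poly_Mapping.single b 1) 1"
  by (simp add: mvar_def mult_single)

lemma carrier_minor:
  "a \<in> V \<Longrightarrow> b \<in> V \<Longrightarrow> c \<in> V \<Longrightarrow> d \<in> V \<Longrightarrow> minor a b c d \<in> carrier (poly_ring V)"
  unfolding minor_def by (intro carrier_intros)

text \<open>The columns of the matrix are the pairs \<open>(a, \<pi> a)\<close> with \<open>a \<in> C\<close>.\<close>

locale two_row =
  fixes V :: "'v::linorder set" and C :: "'v set" and \<pi> :: "'v \<Rightarrow> 'v" and z :: 'v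
  assumes finite_C: "finite C" and C_V: "C \<subseteq> V" and image_V: "\<pi> ` C \<subseteq> V"
    and inj: "inj_on \<pi> C" and disj: "C \<inter> \<pi> ` C = {}" and z_C: "z \<in> C"
begin

definition minors :: "('v, 'k::field) mvpoly set" where
  "minors = {minor a (\<pi> b) b (\<pi> a) | a b. a \<in> C \<and> b \<in> C}"

abbreviation minors_ideal :: "('v, 'k::field) mvpoly set" where
  "minors_ideal \<equiv> Idl\<^bsub>poly_ring V\<^esub> minors"

text \<open>
  The exponent vector of a monomial after the substitution of \<open>x\<^bsub>a\<^esub> x\<^bsub>\<pi> z\<^esub>\<close> for \<open>x\<^bsub>\<pi> a\<^esub>\<close>, for all \<open>a \<in> C\<close>.
  This substitution parametrises the matrices of rank one, so its kernel is the ideal of minors.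
\<close>

definition rank_one_exponent :: "'v monom \<Rightarrow> 'v \<Rightarrow> nat" where
  "rank_one_exponent m v =
    (if v \<in> C then Poly_Mapping.lookup m v + Poly_Mapping.lookup m (\<pi> v)
     else if v = \<pi> z then (\<Sum>a\<in>C. Poly_Mapping.lookup m (\<pi> a))
     else if v \<in> \<pi> ` C then 0 else Poly_Mapping.lookup m v)"

definition rank_one_monom :: "'v monom \<Rightarrow> 'v monom" where
  "rank_one_monom m = Abs_poly_mapping (rank_one_exponent m)"

lemma lookup_rank_one_monom: "Poly_Mapping.lookup (rank_one_monom m) = rank_one_exponent m"
proof -
  have "{v. rank_one_exponent m v \<noteq> 0} \<subseteq> C \<union> {\<pi> z} \<union> Poly_Mapping.keys m"
    by (auto simp: rank_one_exponent_def in_keys_iff split: if_splits)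
  then have "finite {v. rank_one_exponent m v \<noteq> 0}"
    by (rule finite_subset) (simp add: finite_C)
  then show ?thesis
    by (simp add: rank_one_monom_def)
qed

lemma rank_one_monom_add: "rank_one_monom (m + n) = rank_one_monom m + rank_one_monom n"
  by (rule poly_mapping_eqI)
    (simp add: lookup_add lookup_rank_one_monom rank_one_exponent_def sum.distrib)

abbreviation rank_one_map :: "('v, 'k::field) mvpoly \<Rightarrow> ('v, 'k) mvpoly" where
  "rank_one_map \<equiv> monom_map rank_one_monom"

lemma rank_one_map_mult: "rank_one_map (p * q) = rank_one_map p * rank_one_map q"
  by (rule monom_map_mult) (rule rank_one_monom_add)

lemma rank_one_map_1: "rank_one_map (1 :: ('v, 'k::field) mvpoly) = 1"
proof -
  have "rank_one_monom 0 = 0"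
    using rank_one_monom_add[of 0 0] by simp
  then show ?thesis
    using monom_map_single[of rank_one_monom 0 "1::'k"] by simp
qed

text \<open>Both monomials are sent to \<open>x_a x_b x_(\<pi> z)\<close>, which is symmetric in
  \<open>a\<close> and \<open>b\<close>.\<close>

lemma rank_one_monom_exchange:
  assumes "a \<in> C" "b \<in> C"
  shows "rank_one_monom (Poly_Mapping.single a 1 + Poly_Mapping.single (\<pi> b) 1) = rank_one_monom (Poly_Mapping.single b 1 + Poly_Mapping.single (\<pi> a) 1)"
proof (rule poly_mapping_eqI)
  fix v
  have "Poly_Mapping.lookup (Poly_Mapping.single x (1::nat)) y = (if x = y then 1 else 0)" for x y :: 'v
    by (simp add: lookup_single when_def)
  moreover have "\<pi> x \<noteq> y" "y \<noteq> \<pi> x" if "x \<in> C" "y \<in> C" for x y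
    using disj that by auto
  moreover have "\<pi> x = \<pi> y \<longleftrightarrow> x = y" if "x \<in> C" "y \<in> C" for x y
    using inj that by (auto dest: inj_onD)
  moreover have "(\<Sum>c\<in>C. if x = c then 1 else 0) = (1::nat)" if "x \<in> C" for x
    using that finite_C by simp
  ultimately show "Poly_Mapping.lookup (rank_one_monom (Poly_Mapping.single a 1 + Poly_Mapping.single (\<pi> b) 1)) v =
      Poly_Mapping.lookup (rank_one_monom (Poly_Mapping.single b 1 + Poly_Mapping.single (\<pi> a) 1)) v"
    using assms z_C by (auto simp: lookup_rank_one_monom rank_one_exponent_def lookup_add sum.distrib)
qed

lemma minors_carrier: "minors \<subseteq> carrier (poly_ring V)"
  using C_V image_V by (auto simp: minors_def intro!: carrier_minor)

lemma minors_image_iff: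
  "C = f ` S \<Longrightarrow> p \<in> minors \<longleftrightarrow>
    (\<exists>s\<in>S. \<exists>t\<in>S. p = minor (f s) (\<pi> (f t)) (f t) (\<pi> (f s)))"
  unfolding minors_def by blast

lemma ideal_minors_ideal: "ideal minors_ideal (poly_ring V)"
  by (rule ideal_genideal[OF minors_carrier])

lemma minor_in_minors_ideal: "a \<in> C \<Longrightarrow> b \<in> C \<Longrightarrow> minor a (\<pi> b) b (\<pi> a) \<in> minors_ideal"
  using ring.genideal_self[OF ring_poly_ring minors_carrier] unfolding minors_def by blast

lemma rank_one_map_minor:
  assumes "a \<in> C" "b \<in> C"
  shows "rank_one_map (minor a (\<pi> b) b (\<pi> a)) = 0"
  using rank_one_monom_exchange[OF assms]
  by (simp add: minor_def mvar_mult_mvar monom_map_diff)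

lemma ideal_kernel: "ideal {p \<in> carrier (poly_ring V). rank_one_map p = 0} (poly_ring V)"
  by (rule ideal_poly_ringI) (auto simp: carrier_intros monom_map_add rank_one_map_mult)

lemma minors_ideal_le_kernel: "p \<in> minors_ideal \<Longrightarrow> rank_one_map p = 0"
proof -
  have "minors \<subseteq> {p \<in> carrier (poly_ring V). rank_one_map p = 0}"
    using minors_carrier by (auto simp: minors_def rank_one_map_minor)
  then have "minors_ideal \<subseteq> {p \<in> carrier (poly_ring V). rank_one_map p = 0}"
    using genideal_le_iff[OF minors_carrier ideal_kernel] by blast
  then show "p \<in> minors_ideal \<Longrightarrow> rank_one_map p = 0"
    by blast
qed

text \<open>The image remembers the degree of each column (the exponent of \<open>a\<close>), the
  degree of the second row (the exponent of \<open>\<pi> z\<close>) and the exponents off the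
  matrix. Subtracting the second row from the sum of all columns leaves the degree of the first
  row.\<close>

lemma rank_one_monom_eqD:
  assumes "rank_one_monom m = rank_one_monom n"
  shows "a \<in> C \<Longrightarrow> Poly_Mapping.lookup m a + Poly_Mapping.lookup m (\<pi> a) = Poly_Mapping.lookup n a + Poly_Mapping.lookup n (\<pi> a)"
    and "(\<Sum>a\<in>C. Poly_Mapping.lookup m a) = (\<Sum>a\<in>C. Poly_Mapping.lookup n a)"
    and "v \<notin> C \<Longrightarrow> v \<notin> \<pi> ` C \<Longrightarrow> Poly_Mapping.lookup m v = Poly_Mapping.lookup n v"
proof -
  have eq: "rank_one_exponent m v = rank_one_exponent n v" for v
    using assms by (metis lookup_rank_one_monom)
  show *: "Poly_Mapping.lookup m a + Poly_Mapping.lookup m (\<pi> a) = Poly_Mapping.lookup n a + Poly_Mapping.lookup n (\<pi> a)" if "a \<in> C" for a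
    using eq[of a] that by (simp add: rank_one_exponent_def)
  show "Poly_Mapping.lookup m v = Poly_Mapping.lookup n v" if "v \<notin> C" "v \<notin> \<pi> ` C" for v
  proof -
    have "v \<noteq> \<pi> z"
      using that z_C by blast
    then show ?thesis
      using eq[of v] that by (simp add: rank_one_exponent_def)
  qed
  have "\<pi> z \<notin> C"
    using disj z_C by blast
  then have "(\<Sum>a\<in>C. Poly_Mapping.lookup m (\<pi> a)) = (\<Sum>a\<in>C. Poly_Mapping.lookup n (\<pi> a))"
    using eq[of "\<pi> z"] by (simp add: rank_one_exponent_def)
  moreover have "(\<Sum>a\<in>C. Poly_Mapping.lookup m a + Poly_Mapping.lookup m (\<pi> a)) = (\<Sum>a\<in>C. Poly_Mapping.lookup n a + Poly_Mapping.lookup n (\<pi> a))"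
    using * by (rule sum.cong[OF refl])
  ultimately show "(\<Sum>a\<in>C. Poly_Mapping.lookup m a) = (\<Sum>a\<in>C. Poly_Mapping.lookup n a)"
    by (simp add: sum.distrib)
qed

text \<open>An exchange argument for tables with equal row and column sums: if the first rows
  differ, some column \<open>a\<close> has too much there and some column \<open>b\<close> too
  little. Trading \<open>x_a x_(\<pi> b)\<close> for \<open>x_b x_(\<pi> a)\<close> changes the
  monomial by a multiple of a minor and keeps its image.\<close>

lemma monom_diff_in_minors_ideal:
  assumes "m \<in> monoms_in V" "n \<in> monoms_in V" "rank_one_monom m = rank_one_monom n"
  shows "Poly_Mapping.single m 1 - Poly_Mapping.single n 1 \<in> (minors_ideal :: ('v, 'k::field) mvpoly set)"
  using assms
\<comment> \<open>The subtraction is truncated, so the measure counts only the excess of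
  \<open>m\<close> over \<open>n\<close> in the first row.\<close>
proof (induction "\<Sum>a\<in>C. Poly_Mapping.lookup m a - Poly_Mapping.lookup n a" arbitrary: m rule: less_induct)
  case less
  note eqD = rank_one_monom_eqD[OF less.prems(3)]
  show ?case
  proof (cases "\<forall>a\<in>C. Poly_Mapping.lookup m a \<le> Poly_Mapping.lookup n a")
    case True
    have C: "Poly_Mapping.lookup m a = Poly_Mapping.lookup n a" if "a \<in> C" for a
    proof (rule ccontr)
      assume "Poly_Mapping.lookup m a \<noteq> Poly_Mapping.lookup n a"
      then have "(\<Sum>a\<in>C. Poly_Mapping.lookup m a) < (\<Sum>a\<in>C. Poly_Mapping.lookup n a)"
        using True that finite_C by (intro sum_strict_mono_ex1) (auto intro!: bexI[of _ a])
      then show False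
        using eqD(2) by simp
    qed
    have "m = n"
    proof (rule poly_mapping_eqI)
      fix v
      show "Poly_Mapping.lookup m v = Poly_Mapping.lookup n v"
        using C eqD(1,3) by (cases "v \<in> C"; cases "v \<in> \<pi> ` C") fastforce+
    qed
    then show ?thesis
      using ideal_0[OF ideal_minors_ideal] by simp
  next
    case False
    then obtain a where a: "a \<in> C" "Poly_Mapping.lookup m a > Poly_Mapping.lookup n a"
      by auto
    have "\<exists>b\<in>C. Poly_Mapping.lookup m b < Poly_Mapping.lookup n b"
    proof (rule ccontr)
      assume "\<not> ?thesis"
      then have "(\<Sum>a\<in>C. Poly_Mapping.lookup n a) < (\<Sum>a\<in>C. Poly_Mapping.lookup m a)"
        using a finite_C by (intro sum_strict_mono_ex1) auto
      then show False
        using eqD(2) by simp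
    qed
    then obtain b where b: "b \<in> C" "Poly_Mapping.lookup m b < Poly_Mapping.lookup n b"
      by auto
    \<comment> \<open>Since the column sums agree, what column \<open>b\<close> lacks in the first
      row it has in surplus in the second, so \<open>x_(\<pi> b)\<close> divides
      \<open>m\<close>.\<close>
    have \<pi>b: "Poly_Mapping.lookup m (\<pi> b) > 0"
      using eqD(1)[OF b(1)] b(2) by linarith
    have "a \<noteq> b"
      using a b by auto
    have "a \<noteq> \<pi> b" "\<pi> a \<noteq> b" "\<pi> b \<notin> C"
      using disj a(1) b(1) by auto
    define m0 where "m0 = m - (Poly_Mapping.single a 1 + Poly_Mapping.single (\<pi> b) 1)"
    define m' where "m' = m0 + (Poly_Mapping.single b 1 + Poly_Mapping.single (\<pi> a) 1)"
    have m: "m = m0 + (Poly_Mapping.single a 1 + Poly_Mapping.single (\<pi> b) 1)"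
      using a(2) \<pi>b \<open>a \<noteq> \<pi> b\<close>
      by (intro poly_mapping_eqI) (auto simp: m0_def lookup_add lookup_minus lookup_single when_def)
    have "Poly_Mapping.keys m0 \<subseteq> Poly_Mapping.keys m"
      by (auto simp: m0_def in_keys_iff lookup_minus)
    then have m0_in: "m0 \<in> monoms_in V"
      using less.prems(1) by (auto simp: monoms_in_def)
    have "Poly_Mapping.keys m' \<subseteq> Poly_Mapping.keys m0 \<union> {b, \<pi> a}"
      by (auto simp: m'_def in_keys_iff lookup_add lookup_single when_def split: if_splits)
    then have m'_in: "m' \<in> monoms_in V"
      using m0_in a(1) b(1) C_V image_V unfolding monoms_in_def by blast
    have m'_m: "rank_one_monom m' = rank_one_monom m"
      using rank_one_monom_exchange[OF a(1) b(1)]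
      by (simp add: m m'_def rank_one_monom_add[of m0])
    have lookup_m': "Poly_Mapping.lookup m' c = (if c = a then Poly_Mapping.lookup m a - 1 else if c = b then Poly_Mapping.lookup m b + 1 else Poly_Mapping.lookup m c)"
      if "c \<in> C" for c
    proof -
      have "c \<noteq> \<pi> a" "c \<noteq> \<pi> b"
        using disj a(1) b(1) that by auto
      then show ?thesis
        using \<open>a \<noteq> b\<close> a(2)
        by (auto simp: m'_def m0_def lookup_add lookup_minus lookup_single when_def)
    qed
    \<comment> \<open>The summand at \<open>a\<close> drops by one; the one at \<open>b\<close>
      stays \<open>0\<close>, because \<open>m\<close> was strictly below \<open>n\<close>
      there.\<close>
    have "(\<Sum>c\<in>C. Poly_Mapping.lookup m' c - Poly_Mapping.lookup n c) < (\<Sum>c\<in>C. Poly_Mapping.lookup m c - Poly_Mapping.lookup n c)"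
      using a b finite_C by (intro sum_strict_mono_ex1) (auto simp: lookup_m' intro!: bexI[of _ a])
    then have IH: "Poly_Mapping.single m' 1 - Poly_Mapping.single n 1 \<in> (minors_ideal :: ('v, 'k) mvpoly set)"
      using m'_in less.prems(2,3) m'_m by (intro less.hyps) auto
    have "Poly_Mapping.single m 1 - Poly_Mapping.single m' 1 = Poly_Mapping.single m0 1 * (minor a (\<pi> b) b (\<pi> a) :: ('v, 'k) mvpoly)"
      by (simp add: m m'_def minor_def mvar_mult_mvar right_diff_distrib mult_single)
    also have "\<dots> \<in> minors_ideal"
      using a(1) b(1) m0_in
      by (intro ideal_mult[OF ideal_minors_ideal] minor_in_minors_ideal carrier_single)
    finally show ?thesis
      using ideal_add[OF ideal_minors_ideal _ IH] by fastforce
  qed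
qed

text \<open>Group the monomials of \<open>p\<close> by their image and replace each by a
  representative of its group. The replaced sum vanishes, as it is a pushforward of
  \<open>rank_one_map p\<close>, so \<open>p\<close> is a combination of differences of monomials
  with equal image.\<close>

lemma kernel_le_minors_ideal:
  fixes p :: "('v, 'k::field) mvpoly"
  assumes p: "p \<in> carrier (poly_ring V)" and "rank_one_map p = 0"
  shows "p \<in> minors_ideal"
proof -
  define rep where "rep n = (SOME m. m \<in> Poly_Mapping.keys p \<and> rank_one_monom m = n)" for n
  have rep: "rep (rank_one_monom m) \<in> Poly_Mapping.keys p \<and> rank_one_monom (rep (rank_one_monom m)) = rank_one_monom m"
    if "m \<in> Poly_Mapping.keys p" for m
    unfolding rep_def using that by (intro someI_ex[of "\<lambda>m'. m' \<in> Poly_Mapping.keys p \<and> rank_one_monom m' = rank_one_monom m"]) blast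
  have "monom_map (rep \<circ> rank_one_monom) p = 0"
    using assms(2) monom_map_monom_map[of rep rank_one_monom p] by simp
  then have "p = (\<Sum>m\<in>Poly_Mapping.keys p. Poly_Mapping.single m (Poly_Mapping.lookup p m)) - (\<Sum>m\<in>Poly_Mapping.keys p. Poly_Mapping.single (rep (rank_one_monom m)) (Poly_Mapping.lookup p m))"
    by (simp add: sum_single_lookup monom_map_def)
  also have "\<dots> = (\<Sum>m\<in>Poly_Mapping.keys p. Poly_Mapping.single 0 (Poly_Mapping.lookup p m) * (Poly_Mapping.single m 1 - Poly_Mapping.single (rep (rank_one_monom m)) 1))"
    by (simp add: sum_subtractf right_diff_distrib mult_single)
  also have "\<dots> \<in> minors_ideal"
  proof (intro ideal_sum[OF ideal_minors_ideal] ideal_mult[OF ideal_minors_ideal] monom_diff_in_minors_ideal)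
    fix m
    assume m: "m \<in> Poly_Mapping.keys p"
    show "m \<in> monoms_in V" "rep (rank_one_monom m) \<in> monoms_in V"
      using p m rep[OF m] by (auto simp: carrier_poly_ring monoms_in_def)
    show "rank_one_monom m = rank_one_monom (rep (rank_one_monom m))"
      using rep[OF m] by simp
    show "Poly_Mapping.single 0 (Poly_Mapping.lookup p m) \<in> carrier (poly_ring V)"
      by (rule carrier_single) (simp add: monoms_in_def)
  qed
  finally show ?thesis .
qed

text \<open>The ideal is the kernel of a multiplicative map into a domain, hence behaves as a prime
  ideal: multipliers with nonzero image can be cancelled.\<close>

lemma minors_ideal_cancel:
  fixes x u :: "('v, 'k::field) mvpoly"
  assumes "x \<in> carrier (poly_ring V)" "rank_one_map u \<noteq> 0" "x * u \<in> minors_ideal"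
  shows "x \<in> minors_ideal"
proof -
  have "rank_one_map x * rank_one_map u = 0"
    using minors_ideal_le_kernel[OF assms(3)] by (simp add: rank_one_map_mult)
  then show ?thesis
    using assms by (intro kernel_le_minors_ideal) auto
qed

lemma rank_one_map_mvar_nonzero: "rank_one_map (mvar v) \<noteq> 0"
  by (simp add: mvar_def)

text \<open>The substitution leaves the exponent of a variable off the matrix unchanged. If
  \<open>v\<close> occurs in just one of the two terms, their images are different monomials and
  cannot cancel.\<close>

lemma rank_one_map_minor_nonzero:
  assumes "v \<notin> C" "v \<notin> \<pi> ` C" "v \<in> {a, b} \<longleftrightarrow> v \<notin> {c, d}"
  shows "rank_one_map (minor a b c d) \<noteq> 0"
proof -
  have "Poly_Mapping.lookup (Poly_Mapping.single a 1 + Poly_Mapping.single b 1) v \<noteq> Poly_Mapping.lookup (Poly_Mapping.single c 1 + Poly_Mapping.single d (1::nat)) v"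
    using assms(3) by (auto simp: lookup_add lookup_single when_def)
  then have "rank_one_monom (Poly_Mapping.single a 1 + Poly_Mapping.single b 1) \<noteq> rank_one_monom (Poly_Mapping.single c 1 + Poly_Mapping.single d 1)"
    using rank_one_monom_eqD(3) assms(1,2) by metis
  then show ?thesis
    by (auto simp: minor_def mvar_mult_mvar monom_map_diff lookup_single
        dest: arg_cong[of _ _ "\<lambda>p. Poly_Mapping.lookup p (rank_one_monom (Poly_Mapping.single a 1 + Poly_Mapping.single b 1))"])
qed

lemma rank_one_map_prod_nonzero:
  "(\<And>i. i \<in> S \<Longrightarrow> rank_one_map (p i) \<noteq> 0) \<Longrightarrow> rank_one_map (prod p S) \<noteq> 0"
  by (induction S rule: infinite_finite_induct) (auto simp: rank_one_map_mult rank_one_map_1)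

text \<open>
  Modulo the minors of adjacent columns, the minor of the columns \<open>i\<close> and \<open>j\<close> vanishes after
  multiplication by the entries of the first row between them. A minor of adjacent columns need
  not lie in the ideal of \<open>G\<close>, but has a multiple \<open>w * _\<close> there.
\<close>

lemma minors_ideal_in_knutson_class:
  fixes \<alpha> :: "nat \<Rightarrow> 'v" and G :: "('v, 'k::field) mvpoly set"
  assumes C: "C = \<alpha> ` {..n}" and G: "finite G" "G \<noteq> {}" "G \<subseteq> minors_ideal"
    and knutson: "\<And>g. g \<in> G \<Longrightarrow> Idl\<^bsub>poly_ring V\<^esub> {g} \<in> knutson_class (poly_ring V) f"
    and adjacent: "\<And>k. k < n \<Longrightarrow> \<exists>w\<in>carrier (poly_ring V). rank_one_map w \<noteq> 0 \<and>
      w * minor (\<alpha> k) (\<pi> (\<alpha> (Suc k))) (\<alpha> (Suc k)) (\<pi> (\<alpha> k)) \<in> Idl\<^bsub>poly_ring V\<^esub> G"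
  shows "minors_ideal \<in> knutson_class (poly_ring V) f"
proof -
  let ?A = "Idl\<^bsub>poly_ring V\<^esub> G"
  have G_carrier: "G \<subseteq> carrier (poly_ring V)"
    using G(3) ideal_carrier[OF ideal_minors_ideal] by blast
  have A: "ideal ?A (poly_ring V)"
    by (rule ideal_genideal[OF G_carrier])
  have "Idl\<^bsub>poly_ring V\<^esub> (\<Union>((\<lambda>g. {g}) ` G)) \<in> knutson_class (poly_ring V) f"
    using G G_carrier knutson by (intro knutson_class_genideal_Union) auto
  then have A_class: "?A \<in> knutson_class (poly_ring V) f"
    by simp
  define m :: "nat \<Rightarrow> nat \<Rightarrow> ('v, 'k) mvpoly" where "m i j = minor (\<alpha> i) (\<pi> (\<alpha> j)) (\<alpha> j) (\<pi> (\<alpha> i))" for i j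
  define x :: "nat \<Rightarrow> ('v, 'k) mvpoly" where "x k = mvar (\<alpha> k)" for k
  obtain w where w: "\<And>k. k < n \<Longrightarrow> w k \<in> carrier (poly_ring V)" "\<And>k. k < n \<Longrightarrow> rank_one_map (w k) \<noteq> 0"
    "\<And>k. k < n \<Longrightarrow> w k * m k (Suc k) \<in> ?A"
    using adjacent unfolding m_def by metis
  \<comment> \<open>One multiplier that serves all pairs of adjacent columns at once.\<close>
  define W where "W = prod w {..<n}"
  have W: "W \<in> carrier (poly_ring V)"
    unfolding W_def by (intro carrier_prod w) auto
  have x: "x k \<in> carrier (poly_ring V)" if "k \<le> n" for k
    unfolding x_def using C C_V that by (intro carrier_mvar) auto
  have W_adjacent: "W * m k (Suc k) \<in> ?A" if "k < n" for k
  proof -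
    have "W = prod w ({..<n} - {k}) * w k"
      unfolding W_def using that by (subst prod.remove[of _ k]) (auto simp: mult.commute)
    moreover have "prod w ({..<n} - {k}) \<in> carrier (poly_ring V)"
      by (intro carrier_prod w) auto
    ultimately show ?thesis
      using ideal_mult[OF A w(3)[OF that]] by (simp add: mult.assoc)
  qed
  have between: "prod x {i..<j} * W * m i j \<in> ?A" if "i \<le> j" "j \<le> n" for i j
    using that
  proof (induction j rule: dec_induct)
    case base
    then show ?case
      using ideal_0[OF A] by (simp add: m_def minor_def)
  next
    case (step j)
    \<comment> \<open>Expansion of the vanishing \<open>3 \<times> 3\<close> determinant on the
      columns \<open>i\<close>, \<open>j\<close> and \<open>Suc j\<close> whose first row is
      repeated.\<close>
    have x_m: "x j * m i (Suc j) = x i * m j (Suc j) + x (Suc j) * m i j"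
      by (simp add: x_def m_def minor_def algebra_simps)
    have "prod x {i..<Suc j} * W * m i (Suc j) = prod x {i..<j} * W * (x j * m i (Suc j))"
      using step.hyps by (simp add: prod.atLeastLessThan_Suc mult_ac)
    also have "\<dots> = prod x {i..<j} * x i * (W * m j (Suc j)) + x (Suc j) * (prod x {i..<j} * W * m i j)"
      unfolding x_m by (simp add: algebra_simps)
    also have "\<dots> \<in> ?A"
    proof (rule ideal_add[OF A])
      show "prod x {i..<j} * x i * (W * m j (Suc j)) \<in> ?A"
        using step.hyps step.prems
        by (intro ideal_mult[OF A W_adjacent] carrier_mult carrier_prod x) auto
      show "x (Suc j) * (prod x {i..<j} * W * m i j) \<in> ?A"
        using step.prems by (intro ideal_mult[OF A step.IH] x) auto
    qed
    finally show ?case .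
  qed
  \<comment> \<open>All first-row variables are included, not only those between two given columns,
    so that \<open>u\<close> is independent of the pair.\<close>
  define u where "u = prod x {..n} * W"
  have u: "u \<in> carrier (poly_ring V)"
    unfolding u_def by (intro carrier_mult carrier_prod x W) auto
  have u_m: "u * m i j \<in> ?A" if "i \<le> j" "j \<le> n" for i j
  proof -
    have "prod x {..n} = prod x ({..n} - {i..<j}) * prod x {i..<j}"
      using that by (intro prod.subset_diff) auto
    then have "u * m i j = prod x ({..n} - {i..<j}) * (prod x {i..<j} * W * m i j)"
      by (simp add: u_def mult.assoc)
    also have "\<dots> \<in> ?A"
      using that by (intro ideal_mult[OF A] between carrier_prod x) auto
    finally show ?thesis .
  qed
  have u_m': "u * m i j \<in> ?A" if "i \<le> n" "j \<le> n" for i j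
  proof (cases "i \<le> j")
    case False
    then have "u * m i j = - (u * m j i)"
      by (simp add: m_def minor_def algebra_simps)
    then show ?thesis
      using ideal_uminus[OF A u_m[of j i]] False that by simp
  qed (use u_m that in auto)
  have "u * s \<in> ?A" if s: "s \<in> minors" for s
  proof -
    obtain a b where "s = minor a (\<pi> b) b (\<pi> a)" "a \<in> C" "b \<in> C"
      using s unfolding minors_def by blast
    then show ?thesis
      using u_m' unfolding m_def C by auto
  qed
  then have "u * y \<in> ?A" if "y \<in> minors_ideal" for y
    using genideal_mult_le[OF minors_carrier A] that by blast
  moreover have "y \<in> minors_ideal" if "y \<in> carrier (poly_ring V)" "y * u \<in> ?A" for y
  proof (rule minors_ideal_cancel)
    show "rank_one_map u \<noteq> 0"
    proof -
      have "rank_one_map (prod x {..n}) \<noteq> 0"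
        by (rule rank_one_map_prod_nonzero) (simp add: x_def rank_one_map_mvar_nonzero)
      moreover have "rank_one_map W \<noteq> 0"
        unfolding W_def by (rule rank_one_map_prod_nonzero) (simp add: w(2))
      ultimately show ?thesis
        by (simp add: u_def rank_one_map_mult)
    qed
    show "y * u \<in> minors_ideal"
      using that G(3) genideal_le_iff[OF G_carrier ideal_minors_ideal] by blast
  qed (rule that(1))
  ultimately have "ideal_quotient (poly_ring V) ?A (PIdl\<^bsub>poly_ring V\<^esub> u) = minors_ideal"
    using u by (intro ideal_quotient_eqI ideal_minors_ideal A)
  then show ?thesis
    using knutson_class.quotient[OF A_class cring.cgenideal_ideal[OF cring_poly_ring u]] by simp
qed

end

section \<open>Weights and initial monomials\<close>

definition weight :: "('v \<Rightarrow> int) \<Rightarrow> 'v monom \<Rightarrow> int" where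
  "weight w m = (\<Sum>v\<in>Poly_Mapping.keys m. int (Poly_Mapping.lookup m v) * w v)"

lemma weight_superset:
  assumes "finite S" "Poly_Mapping.keys m \<subseteq> S"
  shows "weight w m = (\<Sum>v\<in>S. int (Poly_Mapping.lookup m v) * w v)"
  unfolding weight_def using assms
  by (intro sum.mono_neutral_left) (auto simp: in_keys_iff)

lemma weight_add: "weight w (m + n) = weight w m + weight w n"
proof -
  let ?S = "Poly_Mapping.keys m \<union> Poly_Mapping.keys n"
  have "Poly_Mapping.keys (m + n) \<subseteq> ?S"
    by (rule Poly_Mapping.keys_add)
  then show ?thesis
    by (simp add: weight_superset[of ?S] lookup_add sum.distrib algebra_simps)
qed

lemma weight_0 [simp]: "weight w 0 = 0"
  by (simp add: weight_def)

lemma weight_single [simp]: "weight w (Poly_Mapping.single v (Suc 0)) = w v"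
  by (simp add: weight_def)

text \<open>Ties of weight are broken by the linear order on exponent vectors, which is compatible
  with addition. Initial monomials are computed with \<open>leads\<close>, where ties with the
  leading monomial are excluded.\<close>

definition weight_order :: "'v set \<Rightarrow> ('v::linorder \<Rightarrow> int) \<Rightarrow> 'v monom rel" where
  "weight_order V w = {(m, n). m \<in> monoms_in V \<and> n \<in> monoms_in V \<and>
     (weight w m < weight w n \<or> weight w m = weight w n \<and> m \<le> n)}"

lemma zero_le_monom: "(0 :: 'v::linorder monom) \<le> m"
proof (rule leI)
  show "\<not> m < 0"
    by transfer (auto simp: less_fun_def)
qed

lemma monomial_order_weight_order:
  assumes "\<And>v. 0 \<le> w v"
  shows "monomial_order V (weight_order V w)"
proof -
  let ?r = "weight_order V w"
  have "refl_on (monoms_in V) ?r" "?r \<subseteq> monoms_in V \<times> monoms_in V"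
    by (auto simp: weight_order_def refl_on_def)
  moreover have "trans ?r"
    by (rule transI) (auto simp: weight_order_def)
  moreover have "antisym ?r"
    by (rule antisymI) (auto simp: weight_order_def)
  moreover have "total_on (monoms_in V) ?r"
    by (rule total_onI) (auto simp: weight_order_def)
  moreover have "(0, m) \<in> ?r" if "m \<in> monoms_in V" for m
  proof -
    have "0 \<le> weight w m"
      unfolding weight_def by (intro sum_nonneg mult_nonneg_nonneg) (simp_all add: assms)
    then show ?thesis
      using that zero_le_monom[of m] by (auto simp: weight_order_def monoms_in_def)
  qed
  moreover have "(m + t, n + t) \<in> ?r" if "(m, n) \<in> ?r" "t \<in> monoms_in V" for m n t
  proof -
    have "m + t \<in> monoms_in V" "n + t \<in> monoms_in V"
      using that Poly_Mapping.keys_add[of m t] Poly_Mapping.keys_add[of n t]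
      unfolding monoms_in_def weight_order_def by blast+
    then show ?thesis
      using that by (auto simp: weight_order_def weight_add intro: add_right_mono)
  qed
  ultimately show ?thesis
    unfolding monomial_order_def linear_order_on_def partial_order_on_def preorder_on_def
    by blast
qed

text \<open>A strict maximum of the weight. It passes to products and is an initial monomial however
  ties are broken.\<close>

definition leads :: "('v \<Rightarrow> int) \<Rightarrow> ('v, 'k::zero) mvpoly \<Rightarrow> 'v monom \<Rightarrow> bool" where
  "leads w p m \<longleftrightarrow> m \<in> Poly_Mapping.keys p \<and> (\<forall>n\<in>Poly_Mapping.keys p. n \<noteq> m \<longrightarrow> weight w n < weight w m)"

lemma leads_add:
  fixes r :: "('v, 'k::comm_ring_1) mvpoly"
  assumes "c \<noteq> 0" "\<And>n. n \<in> Poly_Mapping.keys r \<Longrightarrow> weight w n < weight w m"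
  shows "leads w (Poly_Mapping.single m c + r) m"
proof -
  have "Poly_Mapping.lookup r m = 0"
    using assms(2)[of m] by (auto simp: in_keys_iff)
  then have "m \<in> Poly_Mapping.keys (Poly_Mapping.single m c + r)"
    using assms(1) by (simp add: in_keys_iff lookup_add)
  moreover have "n \<in> Poly_Mapping.keys r" if "n \<in> Poly_Mapping.keys (Poly_Mapping.single m c + r)" "n \<noteq> m" for n
    using that by (simp add: in_keys_iff lookup_add lookup_single)
  ultimately show ?thesis
    using assms(2) by (auto simp: leads_def)
qed

lemma leadsE:
  fixes p :: "('v, 'k::comm_ring_1) mvpoly"
  assumes "leads w p m"
  obtains c r where "p = Poly_Mapping.single m c + r" "c \<noteq> 0" "\<And>n. n \<in> Poly_Mapping.keys r \<Longrightarrow> weight w n < weight w m"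
proof
  show "p = Poly_Mapping.single m (Poly_Mapping.lookup p m) + (p - Poly_Mapping.single m (Poly_Mapping.lookup p m))"
    by simp
  show "Poly_Mapping.lookup p m \<noteq> 0"
    using assms by (simp add: leads_def in_keys_iff)
  fix n
  assume "n \<in> Poly_Mapping.keys (p - Poly_Mapping.single m (Poly_Mapping.lookup p m))"
  then show "weight w n < weight w m"
    using assms by (cases "n = m") (auto simp: leads_def in_keys_iff lookup_minus lookup_single)
qed

lemma leads_mult:
  fixes p q :: "('v, 'k::field) mvpoly"
  assumes "leads w p m" "leads w q n"
  shows "leads w (p * q) (m + n)"
proof -
  obtain c r where p: "p = Poly_Mapping.single m c + r" "c \<noteq> 0"
    and r: "\<And>k. k \<in> Poly_Mapping.keys r \<Longrightarrow> weight w k < weight w m"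
    using leadsE[OF assms(1)] by blast
  obtain d s where q: "q = Poly_Mapping.single n d + s" "d \<noteq> 0"
    and s: "\<And>k. k \<in> Poly_Mapping.keys s \<Longrightarrow> weight w k < weight w n"
    using leadsE[OF assms(2)] by blast
  have q_le: "weight w k \<le> weight w n" if "k \<in> Poly_Mapping.keys q" for k
    using assms(2) that by (cases "k = n") (auto simp: leads_def)
  have "p * q = Poly_Mapping.single (m + n) (c * d) + (Poly_Mapping.single m c * s + r * q)"
    by (simp add: p(1) q(1) algebra_simps mult_single)
  moreover have "leads w (Poly_Mapping.single (m + n) (c * d) + (Poly_Mapping.single m c * s + r * q)) (m + n)"
  proof (rule leads_add)
    fix k
    assume "k \<in> Poly_Mapping.keys (Poly_Mapping.single m c * s + r * q)"
    then consider "k \<in> Poly_Mapping.keys (Poly_Mapping.single m c * s)" | "k \<in> Poly_Mapping.keys (r * q)"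
      using Poly_Mapping.keys_add[of "Poly_Mapping.single m c * s" "r * q"] by blast
    then show "weight w k < weight w (m + n)"
    proof cases
      case 1
      then show ?thesis
        using Poly_Mapping.keys_mult[of "Poly_Mapping.single m c" s] p(2) s by (auto simp: weight_add)
    next
      case 2
      then obtain x y where "k = x + y" "x \<in> Poly_Mapping.keys r" "y \<in> Poly_Mapping.keys q"
        using Poly_Mapping.keys_mult[of r q] by blast
      then show ?thesis
        using r[of x] q_le[of y] by (simp add: weight_add)
    qed
  qed (use p(2) q(2) in simp)
  ultimately show ?thesis
    by simp
qed

lemma leads_prod:
  fixes p :: "'i \<Rightarrow> ('v, 'k::field) mvpoly"
  assumes "\<And>i. i \<in> S \<Longrightarrow> leads w (p i) (m i)"
  shows "leads w (prod p S) (sum m S)"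
  using assms
proof (induction S rule: infinite_finite_induct)
  case (insert i S)
  then show ?case
    by (simp add: leads_mult)
qed (simp_all add: leads_def)

lemma leads_nonzero: "leads w p m \<Longrightarrow> p \<noteq> 0"
  by (auto simp: leads_def)

lemma has_squarefree_initial_monomialI:
  fixes p :: "('v::linorder, 'k::field) mvpoly"
  assumes "\<And>v. 0 \<le> w v" "p \<in> carrier (poly_ring V)" "leads w p m" "squarefree_monomial m"
  shows "has_squarefree_initial_monomial V p"
proof -
  have "is_initial_monomial (weight_order V w) p m"
    using assms(2,3) unfolding is_initial_monomial_def leads_def weight_order_def
    by (auto simp: carrier_poly_ring monoms_in_def)
  then show ?thesis
    using monomial_order_weight_order[of w V] assms(1,4)
    unfolding has_squarefree_initial_monomial_def by blast
qed

definition indicator_monom :: "'v set \<Rightarrow> 'v monom" where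
  "indicator_monom X = (\<Sum>v\<in>X. Poly_Mapping.single v 1)"

lemma squarefree_sum_indicator_monom:
  assumes "finite S" "\<And>i. i \<in> S \<Longrightarrow> finite (X i)"
    and "\<And>i j. i \<in> S \<Longrightarrow> j \<in> S \<Longrightarrow> i \<noteq> j \<Longrightarrow> X i \<inter> X j = {}"
  shows "squarefree_monomial (\<Sum>i\<in>S. indicator_monom (X i))"
proof -
  have "(\<Sum>i\<in>S. indicator_monom (X i)) = (\<Sum>v\<in>\<Union>(X ` S). Poly_Mapping.single v 1)"
    unfolding indicator_monom_def using assms by (intro sum.UNION_disjoint[symmetric]) auto
  moreover have "finite (\<Union>(X ` S))"
    using assms by blast
  ultimately show ?thesis
    by (simp add: squarefree_monomial_def lookup_sum lookup_single when_def)
qed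

section \<open>Minors of cells and of \<open>3 \<times> 3\<close> blocks\<close>

definition cell_minor :: "nat \<times> nat \<Rightarrow> (nat \<times> nat, 'k::comm_ring_1) mvpoly" where
  "cell_minor a = minor a (cell_top a) (upper_left a (cell_top a)) (lower_right a (cell_top a))"

lemma cell_minor_Pair: "cell_minor (i, j) = minor (i, j) (Suc i, Suc j) (i, Suc j) (Suc i, j)"
  by (simp add: cell_minor_def cell_top_def upper_left_def lower_right_def)

definition entry :: "'v set \<Rightarrow> 'v \<Rightarrow> ('v, 'k::comm_ring_1) mvpoly" where
  "entry V v = (if v \<in> V then mvar v else 0)"

lemma carrier_entry: "entry V v \<in> carrier (poly_ring V)"
  by (simp add: entry_def carrier_mvar carrier_0)

text \<open>
  Two cells that touch at the centre of a \<open>3 \<times> 3\<close> block of vertices, along its anti-diagonal, share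
  the central variable, so the product of their minors has no square-free initial monomial. The
  determinant of the block replaces it; at most two corners of the block are not vertices, and
  their entries are put to \<open>0\<close>.
\<close>

definition block_det :: "(nat \<times> nat) set \<Rightarrow> nat \<times> nat \<Rightarrow> (nat \<times> nat, 'k::comm_ring_1) mvpoly" where
  "block_det V a = (let z = (\<lambda>s t. entry V (fst a + s, snd a + t)) in
     z 0 0 * (z 1 1 * z 2 2 - z 1 2 * z 2 1) - z 0 1 * (z 1 0 * z 2 2 - z 1 2 * z 2 0)
     + z 0 2 * (z 1 0 * z 2 1 - z 1 1 * z 2 0))"

lemma block_det_Pair:
  "block_det V (i, j) =
     entry V (i, j) * (entry V (Suc i, Suc j) * entry V (Suc (Suc i), Suc (Suc j)) - entry V (Suc i, Suc (Suc j)) * entry V (Suc (Suc i), Suc j))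
   - entry V (i, Suc j) * (entry V (Suc i, j) * entry V (Suc (Suc i), Suc (Suc j)) - entry V (Suc i, Suc (Suc j)) * entry V (Suc (Suc i), j))
   + entry V (i, Suc (Suc j)) * (entry V (Suc i, j) * entry V (Suc (Suc i), Suc j) - entry V (Suc i, Suc j) * entry V (Suc (Suc i), j))"
  by (simp add: block_det_def Let_def numeral_2_eq_2)

lemma carrier_block_det: "block_det V a \<in> carrier (poly_ring V)"
  by (cases a) (simp only: block_det_Pair carrier_entry carrier_intros)

definition entry_minor :: "'v set \<Rightarrow> 'v \<Rightarrow> 'v \<Rightarrow> 'v \<Rightarrow> 'v \<Rightarrow> ('v, 'k::comm_ring_1) mvpoly" where
  "entry_minor V a b c d = entry V a * entry V b - entry V c * entry V d"

lemma entry_minor_eq_minor: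
  "a \<in> V \<Longrightarrow> b \<in> V \<Longrightarrow> c \<in> V \<Longrightarrow> d \<in> V \<Longrightarrow> entry_minor V a b c d = minor a b c d"
  by (simp add: entry_minor_def entry_def minor_def)

lemma ideal_combination:
  fixes I :: "('v, 'k::comm_ring_1) mvpoly set"
  assumes "ideal I (poly_ring V)" "a \<in> I" "b \<in> I" "c \<in> I"
  shows "entry V x * a - entry V y * b + entry V z * c \<in> I"
  by (rule ideal_add[OF assms(1) ideal_diff[OF assms(1) ideal_mult[OF assms(1,2) carrier_entry]
        ideal_mult[OF assms(1,3) carrier_entry]] ideal_mult[OF assms(1,4) carrier_entry]])

text \<open>Laplace expansion along the row of the block that is neither \<open>y\<close> nor
  \<open>Suc y\<close>; the cofactors are the \<open>2\<close>-minors of these two rows. Entries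
  padded with \<open>0\<close> can occur only outside the strip.\<close>

lemma block_det_in_ideal_rows:
  fixes I :: "(nat \<times> nat, 'k::comm_ring_1) mvpoly set"
  assumes I: "ideal I (poly_ring V)" and "y = Suc j \<or> y = j"
    and "\<And>s t. s < t \<Longrightarrow> t \<le> Suc (Suc i) \<Longrightarrow> i \<le> s \<Longrightarrow> entry_minor V (s, y) (t, Suc y) (s, Suc y) (t, y) \<in> I"
  shows "block_det V (i, j) \<in> I"
proof -
  define D :: "nat \<Rightarrow> nat \<Rightarrow> (nat \<times> nat, 'k) mvpoly" where "D s t = entry_minor V (s, y) (t, Suc y) (s, Suc y) (t, y)" for s t
  have D: "D i (Suc i) \<in> I" "D i (Suc (Suc i)) \<in> I" "D (Suc i) (Suc (Suc i)) \<in> I"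
    using assms(3) unfolding D_def by auto
  let ?r = "if y = j then Suc (Suc j) else j"
  have "block_det V (i, j) = entry V (i, ?r) * D (Suc i) (Suc (Suc i))
      - entry V (Suc i, ?r) * D i (Suc (Suc i)) + entry V (Suc (Suc i), ?r) * D i (Suc i)"
    using assms(2) by (auto simp: block_det_Pair D_def entry_minor_def algebra_simps)
  then show ?thesis
    using ideal_combination[OF I D(3,2,1)] by metis
qed

lemma block_det_in_ideal_columns:
  fixes I :: "(nat \<times> nat, 'k::comm_ring_1) mvpoly set"
  assumes I: "ideal I (poly_ring V)" and "x = Suc i \<or> x = i"
    and "\<And>s t. s < t \<Longrightarrow> t \<le> Suc (Suc j) \<Longrightarrow> j \<le> s \<Longrightarrow> entry_minor V (x, s) (Suc x, t) (x, t) (Suc x, s) \<in> I"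
  shows "block_det V (i, j) \<in> I"
proof -
  define D :: "nat \<Rightarrow> nat \<Rightarrow> (nat \<times> nat, 'k) mvpoly" where "D s t = entry_minor V (x, s) (Suc x, t) (x, t) (Suc x, s)" for s t
  have D: "D j (Suc j) \<in> I" "D j (Suc (Suc j)) \<in> I" "D (Suc j) (Suc (Suc j)) \<in> I"
    using assms(3) unfolding D_def by auto
  let ?r = "if x = i then Suc (Suc i) else i"
  have "block_det V (i, j) = entry V (?r, j) * D (Suc j) (Suc (Suc j))
      - entry V (?r, Suc j) * D j (Suc (Suc j)) + entry V (?r, Suc (Suc j)) * D j (Suc j)"
    using assms(2) by (auto simp: block_det_Pair D_def entry_minor_def algebra_simps)
  then show ?thesis
    using ideal_combination[OF I D(3,2,1)] by metis
qed

text \<open>The Desnanot--Jacobi identity for the block expresses the product through its other two cell minors.\<close>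

lemma cell_minor_mult_in_ideal:
  fixes I :: "(nat \<times> nat, 'k::comm_ring_1) mvpoly set"
  assumes I: "ideal I (poly_ring V)" and det: "block_det V (i, j) \<in> I"
    and V: "{(i, Suc j), (Suc i, Suc j), (i, Suc (Suc j)), (Suc i, Suc (Suc j)), (Suc i, j),
      (Suc (Suc i), j), (Suc (Suc i), Suc j)} \<subseteq> V"
    and third: "(i, j) \<in> V \<and> cell_minor (i, j) \<in> I \<or>
      (Suc (Suc i), Suc (Suc j)) \<in> V \<and> cell_minor (Suc i, Suc j) \<in> I"
  shows "cell_minor (i, Suc j) * cell_minor (Suc i, j) \<in> I"
proof -
  \<comment> \<open>Only one of the two cells on the main diagonal of the block is known to have all
    its vertices in \<open>V\<close>. Padding keeps the identity valid when the outer vertex of the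
    other is missing; as \<open>L\<close> and \<open>U\<close> enter only through their product, one
    of them in \<open>I\<close> is enough.\<close>
  define L :: "(nat \<times> nat, 'k) mvpoly" where "L = entry_minor V (i, j) (Suc i, Suc j) (i, Suc j) (Suc i, j)"
  define U :: "(nat \<times> nat, 'k) mvpoly" where "U = entry_minor V (Suc i, Suc j) (Suc (Suc i), Suc (Suc j)) (Suc i, Suc (Suc j)) (Suc (Suc i), Suc j)"
  have "L \<in> carrier (poly_ring V)" "U \<in> carrier (poly_ring V)"
    unfolding L_def U_def entry_minor_def by (intro carrier_diff carrier_mult carrier_entry)+
  moreover have "L \<in> I \<or> U \<in> I"
    using third V by (auto simp: L_def U_def entry_minor_eq_minor cell_minor_Pair)
  ultimately have "U * L \<in> I"
    using ideal_mult[OF I] by (metis mult.commute)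
  moreover have "entry V (Suc i, Suc j) * block_det V (i, j) \<in> I"
    by (rule ideal_mult[OF I det carrier_entry])
  moreover have "cell_minor (i, Suc j) * cell_minor (Suc i, j) =
      U * L - entry V (Suc i, Suc j) * block_det V (i, j)"
    using V unfolding block_det_Pair L_def U_def cell_minor_Pair minor_def entry_minor_def
    by (simp add: entry_def algebra_simps)
  ultimately show ?thesis
    using ideal_diff[OF I] by metis
qed

text \<open>
  Up to terms that every bijection of rows and columns contributes equally, a monomial
  \<open>\<Prod> x\<^bsub>(i, j)\<^esub>\<close> has the weight \<open>- 2 \<Sum> i j\<close>; the anti-diagonal maximises it.
\<close>

definition distance_weight :: "nat \<times> nat \<Rightarrow> int" where
  "distance_weight v = (int (fst v) - int (snd v))\<^sup>2"

lemma leads_cell_minor: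
  "leads distance_weight (cell_minor (i, j) :: (nat \<times> nat, 'k::field) mvpoly)
     (indicator_monom {(i, Suc j), (Suc i, j)})"
proof -
  have "leads distance_weight (Poly_Mapping.single (indicator_monom {(i, Suc j), (Suc i, j)}) (- 1) +
      (mvar (i, j) * mvar (Suc i, Suc j) :: (nat \<times> nat, 'k) mvpoly))
      (indicator_monom {(i, Suc j), (Suc i, j)})"
    by (rule leads_add)
      (auto simp: indicator_monom_def mvar_mult_mvar weight_add distance_weight_def
        power2_eq_square algebra_simps)
  then show ?thesis
    by (simp add: cell_minor_Pair minor_def mvar_mult_mvar indicator_monom_def single_uminus)
qed

definition low :: "int \<Rightarrow> (nat \<times> nat, 'k::comm_ring_1) mvpoly \<Rightarrow> bool" where
  "low B p \<longleftrightarrow> (\<forall>n\<in>Poly_Mapping.keys p. weight distance_weight n < B)"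

lemma low_diff: "low B p \<Longrightarrow> low B q \<Longrightarrow> low B (p - q)"
  by (auto simp: low_def in_keys_iff lookup_minus)

lemma low_add: "low B p \<Longrightarrow> low B q \<Longrightarrow> low B (p + q)"
  using Poly_Mapping.keys_add[of p q] by (auto simp: low_def)

lemma low_entries:
  assumes "distance_weight a + distance_weight b + distance_weight c < B"
  shows "low B (entry V a * entry V b * entry V c :: (nat \<times> nat, 'k::field) mvpoly)"
  using assms by (auto simp: low_def entry_def mvar_def mult_single weight_add)

lemma leads_block_det:
  assumes V: "{(i, Suc (Suc j)), (Suc i, Suc j), (Suc (Suc i), j)} \<subseteq> V"
  shows "leads distance_weight (block_det V (i, j) :: (nat \<times> nat, 'k::field) mvpoly)
     (indicator_monom {(i, Suc (Suc j)), (Suc i, Suc j), (Suc (Suc i), j)})"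
    (is "leads _ _ ?m")
proof -
  define z :: "nat \<Rightarrow> nat \<Rightarrow> (nat \<times> nat, 'k) mvpoly" where "z s t = entry V (i + s, j + t)" for s t
  define r where "r = z 0 0 * z 1 1 * z 2 2 - z 0 0 * z 1 2 * z 2 1 - z 0 1 * z 1 0 * z 2 2
    + z 0 1 * z 1 2 * z 2 0 + z 0 2 * z 1 0 * z 2 1"
  \<comment> \<open>With \<open>d = i - j\<close> the anti-diagonal has weight
    \<open>3 d^2 + 8\<close>; the other five terms, if nonzero, have weight at most
    \<open>3 d^2 + 6\<close>.\<close>
  have "low (weight distance_weight ?m) r"
    unfolding r_def z_def
    by (intro low_add low_diff low_entries;
        simp add: indicator_monom_def weight_add distance_weight_def power2_eq_square algebra_simps)
  then have "leads distance_weight (Poly_Mapping.single ?m (- 1) + r) ?m"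
    by (intro leads_add) (simp_all add: low_def)
  moreover have "block_det V (i, j) = r - z 0 2 * z 1 1 * z 2 0"
    by (simp add: block_det_def r_def z_def Let_def algebra_simps)
  moreover have "z 0 2 * z 1 1 * z 2 0 = Poly_Mapping.single ?m 1"
    using V by (simp add: z_def entry_def mvar_def mult_single indicator_monom_def numeral_2_eq_2 algebra_simps)
  ultimately show ?thesis
    by (simp add: single_uminus)
qed

section \<open>Strips of a thin collection of cells\<close>

lemma cell_subset_iff:
  "cell (x, y) \<subseteq> lattice_interval (a, b) (c, d) \<longleftrightarrow> a \<le> x \<and> b \<le> y \<and> x < c \<and> y < d"
proof
  assume "cell (x, y) \<subseteq> lattice_interval (a, b) (c, d)"
  moreover have "(x, y) \<in> cell (x, y)" "(Suc x, Suc y) \<in> cell (x, y)"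
    by (simp_all add: cell_def lattice_interval_def cell_top_def)
  ultimately have "(x, y) \<in> lattice_interval (a, b) (c, d)" "(Suc x, Suc y) \<in> lattice_interval (a, b) (c, d)"
    by blast+
  then show "a \<le> x \<and> b \<le> y \<and> x < c \<and> y < d"
    by (simp add: lattice_interval_def)
qed (auto simp: cell_def lattice_interval_def cell_top_def)

lemma inj_cell: "inj cell"
proof (rule injI)
  fix a b
  assume eq: "cell a = cell b"
  obtain x y x' y' where "a = (x, y)" "b = (x', y')"
    by (cases a, cases b)
  moreover have "cell (s, t) = lattice_interval (s, t) (Suc s, Suc t)" for s t
    by (simp add: cell_def cell_top_def)
  ultimately show "a = b"
    using eq cell_subset_iff[of x y x' y' "Suc x'" "Suc y'"] cell_subset_iff[of x' y' x y "Suc x" "Suc y"]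
    by simp
qed

lemma lattice_interval_subset_iff:
  assumes "a < c" "b < d"
  shows "lattice_interval (a, b) (c, d) \<subseteq> lattice_interval (a', b') (c', d') \<longleftrightarrow>
    a' \<le> a \<and> b' \<le> b \<and> c \<le> c' \<and> d \<le> d'"
proof
  assume "lattice_interval (a, b) (c, d) \<subseteq> lattice_interval (a', b') (c', d')"
  moreover have "(a, b) \<in> lattice_interval (a, b) (c, d)" "(c, d) \<in> lattice_interval (a, b) (c, d)"
    using assms by (simp_all add: lattice_interval_def)
  ultimately have "(a, b) \<in> lattice_interval (a', b') (c', d')" "(c, d) \<in> lattice_interval (a', b') (c', d')"
    by blast+
  then show "a' \<le> a \<and> b' \<le> b \<and> c \<le> c' \<and> d \<le> d'"
    by (simp add: lattice_interval_def)
qed (auto simp: lattice_interval_def)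

lemma vertex_set_iff:
  "(x, y) \<in> vertex_set P \<longleftrightarrow> (\<exists>i j. cell (i, j) \<in> P \<and> (x = i \<or> x = Suc i) \<and> (y = j \<or> y = Suc j))"
  by (auto simp: vertex_set_def interval_vertices_def cell_top_def upper_left_def lower_right_def)

lemma cell_vertices:
  assumes "cell (i, j) \<in> P"
  shows "(i, j) \<in> vertex_set P" "(Suc i, j) \<in> vertex_set P" "(i, Suc j) \<in> vertex_set P"
    "(Suc i, Suc j) \<in> vertex_set P"
  using assms by (auto simp: vertex_set_iff)

lemma has_cell_upper_left_iff:
  "has_cell_upper_left P (x, y) \<longleftrightarrow> (\<exists>j. y = Suc j \<and> cell (x, j) \<in> P)"
  by (auto simp: has_cell_upper_left_def upper_left_def cell_top_def)

lemma has_cell_lower_right_iff: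
  "has_cell_lower_right P (x, y) \<longleftrightarrow> (\<exists>i. x = Suc i \<and> cell (i, y) \<in> P)"
  by (auto simp: has_cell_lower_right_def lower_right_def cell_top_def)

lemma inner_interval_vertex:
  assumes cells: "\<And>x y. a \<le> x \<Longrightarrow> x < c \<Longrightarrow> b \<le> y \<Longrightarrow> y < d \<Longrightarrow> cell (x, y) \<in> P"
    and "a < c" "b < d" "a \<le> x" "x \<le> c" "b \<le> y" "y \<le> d"
  shows "(x, y) \<in> vertex_set P"
proof -
  \<comment> \<open>On the right or upper border the point belongs to the last cell before the
    border; the bounds \<open>a < c\<close> and \<open>b < d\<close> make the subtraction
    exact.\<close>
  define s where "s = (if x = c then x - 1 else x)"
  define t where "t = (if y = d then y - 1 else y)"
  have "cell (s, t) \<in> P"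
    using assms(2-) by (intro cells) (auto simp: s_def t_def)
  moreover have "x = s \<or> x = Suc s" "y = t \<or> y = Suc t"
    using assms(2-) by (auto simp: s_def t_def)
  ultimately show ?thesis
    unfolding vertex_set_iff by blast
qed

lemma inner_interval_iff:
  "inner_interval P (a, b) (c, d) \<longleftrightarrow>
    a < c \<and> b < d \<and> (\<forall>x y. a \<le> x \<and> x < c \<and> b \<le> y \<and> y < d \<longrightarrow> cell (x, y) \<in> P)"
  using inner_interval_vertex[of a c b d P a b] inner_interval_vertex[of a c b d P c d]
  by (auto simp: inner_interval_def proper_interval_def cell_subset_iff)

lemma maximal_inner_intervalD: "maximal_inner_interval P a b \<Longrightarrow> inner_interval P a b"
  by (simp add: maximal_inner_interval_def)

text \<open>Cells are named by their lower-left vertices.\<close>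

definition lonely :: "(nat \<times> nat) set set \<Rightarrow> nat \<times> nat \<Rightarrow> bool" where
  "lonely P = (\<lambda>(i, j). cell (i, j) \<in> P \<and> (\<forall>i'. i = Suc i' \<longrightarrow> cell (i', Suc j) \<notin> P) \<and>
     (\<forall>j'. j = Suc j' \<longrightarrow> cell (Suc i, j') \<notin> P))"

text \<open>A block is named by the lower-left corner of its grid of nine points; this corner need
  not be a vertex of \<open>P\<close>.\<close>

definition blocks :: "(nat \<times> nat) set set \<Rightarrow> (nat \<times> nat) set" where
  "blocks P = {(i, j). cell (i, Suc j) \<in> P \<and> cell (Suc i, j) \<in> P}"

text \<open>The tags are essential: one pair may name both a lonely cell and the block whose
  lower-left cell it is, and both factors must occur in the product.\<close>

definition factor_index :: "(nat \<times> nat) set set \<Rightarrow> (nat \<times> nat + nat \<times> nat) set" where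
  "factor_index P = Inl ` {a. lonely P a} \<union> Inr ` blocks P"

definition factor :: "(nat \<times> nat) set set \<Rightarrow> nat \<times> nat + nat \<times> nat \<Rightarrow> (nat \<times> nat, 'k::comm_ring_1) mvpoly" where
  "factor P = case_sum cell_minor (block_det (vertex_set P))"

text \<open>The variables of the anti-diagonal term, which will be the leading monomial of the
  factor.\<close>

definition factor_support :: "nat \<times> nat + nat \<times> nat \<Rightarrow> (nat \<times> nat) set" where
  "factor_support = case_sum (\<lambda>(i, j). {(i, Suc j), (Suc i, j)})
     (\<lambda>(i, j). {(i, Suc (Suc j)), (Suc i, Suc j), (Suc (Suc i), j)})"

definition knutson_poly :: "(nat \<times> nat) set set \<Rightarrow> (nat \<times> nat, 'k::comm_ring_1) mvpoly" where
  "knutson_poly P = prod (factor P) (factor_index P)"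

lemma minor_swap: "minor a b c d = minor b a c d" "minor a b c d = minor a b d c"
  by (simp_all add: minor_def mult.commute)

lemma carrier_cell_minor: "cell a \<in> P \<Longrightarrow> cell_minor a \<in> carrier (poly_ring (vertex_set P))"
  by (cases a) (simp add: cell_minor_Pair carrier_minor cell_vertices)

section \<open>Combinatorial consequences of the hypotheses on the collection\<close>

locale admissible_collection =
  fixes P :: "(nat \<times> nat) set set"
  assumes collection: "cell_collection P" and thin: "thin P"
    and no_diagonal: "\<not> (\<exists>i j. has_cell_upper_left P (i, j) \<and> has_cell_upper_left P (i + 1, j - 1) \<and>
                has_cell_upper_left P (i + 2, j - 2))"
    and vertical: "\<And>i1 j1 j2. j1 < j2 \<Longrightarrow> maximal_inner_interval P (i1, j1) (i1 + 1, j2) \<Longrightarrow>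
           \<not> has_cell_lower_right P (i1, j2) \<and> \<not> has_cell_upper_left P (i1 + 1, j1)"
    and horizontal: "\<And>i1 i2 j1. i1 < i2 \<Longrightarrow> maximal_inner_interval P (i1, j1) (i2, j1 + 1) \<Longrightarrow>
           \<not> has_cell_lower_right P (i1, j1 + 1) \<and> \<not> has_cell_upper_left P (i2, j1)"
begin

abbreviation "V \<equiv> vertex_set P"

lemma finite_cells: "finite {a. cell a \<in> P}"
  using finite_vimageI[OF _ inj_cell, of P] collection by (simp add: cell_collection_def vimage_def)

lemma finite_V: "finite V"
  using finite_cells by (auto simp: vertex_set_def interval_vertices_def)

lemma not_square:
  "cell (i, j) \<in> P \<Longrightarrow> cell (Suc i, j) \<in> P \<Longrightarrow> cell (i, Suc j) \<in> P \<Longrightarrow> cell (Suc i, Suc j) \<notin> P"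
  using thin by (auto simp: thin_def)

lemma no_three:
  "cell (i, Suc (Suc j)) \<in> P \<Longrightarrow> cell (Suc i, Suc j) \<in> P \<Longrightarrow> cell (Suc (Suc i), j) \<notin> P"
proof
  assume "cell (i, Suc (Suc j)) \<in> P" "cell (Suc i, Suc j) \<in> P" "cell (Suc (Suc i), j) \<in> P"
  then have "has_cell_upper_left P (i, j + 3)" "has_cell_upper_left P (i + 1, j + 3 - 1)"
    "has_cell_upper_left P (i + 2, j + 3 - 2)"
    by (simp_all add: has_cell_upper_left_iff numeral_3_eq_3)
  then show False
    using no_diagonal by blast
qed

lemma inner_interval_strip:
  assumes "inner_interval P (a, b) (c, d)"
  shows "c = Suc a \<or> d = Suc b"
proof (rule ccontr)
  assume "\<not> ?thesis"
  moreover have "cell (x, y) \<in> P" if "a \<le> x" "x < c" "b \<le> y" "y < d" for x y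
    using assms that by (auto simp: inner_interval_iff)
  moreover have "a < c" "b < d"
    using assms by (auto simp: inner_interval_iff)
  ultimately show False
    using not_square[of a b] by auto
qed

lemma maximal_inner_interval_exists:
  assumes "inner_interval P (a, b) (c, d)"
  obtains a' b' c' d' where "maximal_inner_interval P (a', b') (c', d')" "a' \<le> a" "b' \<le> b" "c \<le> c'" "d \<le> d'"
proof -
  let ?S = "{lattice_interval u v | u v. inner_interval P u v}"
  have "?S \<subseteq> (\<lambda>(u, v). lattice_interval u v) ` (V \<times> V)"
    by (auto simp: inner_interval_def)
  then have "finite ?S"
    by (rule finite_subset) (simp add: finite_V)
  moreover have "lattice_interval (a, b) (c, d) \<in> ?S"
    using assms by blast
  ultimately obtain M where M: "M \<in> ?S" "lattice_interval (a, b) (c, d) \<subseteq> M" "\<And>N. N \<in> ?S \<Longrightarrow> M \<subseteq> N \<Longrightarrow> M = N"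
    by (metis (no_types, lifting) finite_has_maximal2)
  obtain a' b' c' d' where M': "M = lattice_interval (a', b') (c', d')" "inner_interval P (a', b') (c', d')"
    using M(1) by auto
  have "maximal_inner_interval P (a', b') (c', d')"
    unfolding maximal_inner_interval_def using M' M(3) by blast
  then show ?thesis
    using that M(2) assms unfolding M'(1) inner_interval_iff
    by (simp add: lattice_interval_subset_iff)
qed

lemma maximal_horizontal:
  assumes "cell (i, j) \<in> P" "cell (Suc i, j) \<in> P"
  obtains i1 i2 where "maximal_inner_interval P (i1, j) (i2, Suc j)" "i1 \<le> i" "Suc (Suc i) \<le> i2"
proof -
  have "inner_interval P (i, j) (Suc (Suc i), Suc j)"
    using assms by (auto simp: inner_interval_iff less_Suc_eq le_less)
  then obtain a b c d where m: "maximal_inner_interval P (a, b) (c, d)" "a \<le> i" "b \<le> j" "Suc (Suc i) \<le> c" "Suc j \<le> d"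
    by (rule maximal_inner_interval_exists)
  then have "c = Suc a \<or> d = Suc b"
    using inner_interval_strip maximal_inner_intervalD by blast
  \<comment> \<open>Width at least two leaves only height one, which determines the row.\<close>
  then have "b = j" "d = Suc j"
    using m by auto
  then show ?thesis
    using that m by blast
qed

lemma maximal_vertical:
  assumes "cell (i, j) \<in> P" "cell (i, Suc j) \<in> P"
  obtains j1 j2 where "maximal_inner_interval P (i, j1) (Suc i, j2)" "j1 \<le> j" "Suc (Suc j) \<le> j2"
proof -
  have "inner_interval P (i, j) (Suc i, Suc (Suc j))"
    using assms by (auto simp: inner_interval_iff less_Suc_eq le_less)
  then obtain a b c d where m: "maximal_inner_interval P (a, b) (c, d)" "a \<le> i" "b \<le> j" "Suc i \<le> c" "Suc (Suc j) \<le> d"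
    by (rule maximal_inner_interval_exists)
  then have "c = Suc a \<or> d = Suc b"
    using inner_interval_strip maximal_inner_intervalD by blast
  then have "a = i" "c = Suc i"
    using m by auto
  then show ?thesis
    using that m by blast
qed

lemma maximal_inner_interval_cells:
  "maximal_inner_interval P (a, b) (c, d) \<Longrightarrow> a \<le> x \<Longrightarrow> x < c \<Longrightarrow> b \<le> y \<Longrightarrow> y < d \<Longrightarrow> cell (x, y) \<in> P"
  using maximal_inner_intervalD[of P "(a, b)" "(c, d)"] by (simp add: inner_interval_iff)

lemma maximal_horizontal_corners:
  assumes "maximal_inner_interval P (i1, j) (i2, Suc j)"
  shows "i1 = Suc i \<Longrightarrow> cell (i, Suc j) \<notin> P" "j = Suc j' \<Longrightarrow> cell (i2, j') \<notin> P"
proof -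
  have "i1 < i2"
    using maximal_inner_intervalD[OF assms] by (simp add: inner_interval_iff)
  then have "\<not> has_cell_lower_right P (i1, Suc j) \<and> \<not> has_cell_upper_left P (i2, j)"
    using horizontal[of i1 i2 j] assms by simp
  then show "i1 = Suc i \<Longrightarrow> cell (i, Suc j) \<notin> P" "j = Suc j' \<Longrightarrow> cell (i2, j') \<notin> P"
    unfolding has_cell_upper_left_iff has_cell_lower_right_iff by blast+
qed

lemma maximal_vertical_corners:
  assumes "maximal_inner_interval P (i, j1) (Suc i, j2)"
  shows "i = Suc i' \<Longrightarrow> cell (i', j2) \<notin> P" "j1 = Suc j \<Longrightarrow> cell (Suc i, j) \<notin> P"
proof -
  have "j1 < j2"
    using maximal_inner_intervalD[OF assms] by (simp add: inner_interval_iff)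
  then have "\<not> has_cell_lower_right P (i, j2) \<and> \<not> has_cell_upper_left P (Suc i, j1)"
    using vertical[of j1 j2 i] assms by simp
  then show "i = Suc i' \<Longrightarrow> cell (i', j2) \<notin> P" "j1 = Suc j \<Longrightarrow> cell (Suc i, j) \<notin> P"
    unfolding has_cell_upper_left_iff has_cell_lower_right_iff by blast+
qed

text \<open>By thinness the upper-right cell of the block is missing. An upper-left neighbour of
  \<open>(i, j)\<close> would form a horizontal strip with \<open>(i, Suc j)\<close> that ends at
  the centre of the block; there the cell \<open>(Suc i, j)\<close> touches its lower-right corner,
  against condition (3). A lower-right neighbour gives a vertical strip ending at the same point,
  whose upper-left corner touches \<open>(i, Suc j)\<close>, against condition (2).\<close>

lemma lower_lonely:
  assumes D: "cell (i, Suc j) \<in> P" and C: "cell (Suc i, j) \<in> P" and L: "cell (i, j) \<in> P"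
  shows "lonely P (i, j)"
proof -
  have U: "cell (Suc i, Suc j) \<notin> P"
    using not_square L C D by blast
  have "cell (i', Suc j) \<notin> P" if i: "i = Suc i'" for i'
  proof
    assume "cell (i', Suc j) \<in> P"
    then obtain i1 i2 where m: "maximal_inner_interval P (i1, Suc j) (i2, Suc (Suc j))" "i1 \<le> i'" "Suc i \<le> i2"
      using maximal_horizontal[of i' "Suc j"] D i by auto
    have "i2 = Suc i"
      using maximal_inner_interval_cells[OF m(1), of "Suc i" "Suc j"] U m i by (cases "i2 = Suc i") auto
    then show False
      using maximal_horizontal_corners(2)[OF m(1)] C by simp
  qed
  moreover have "cell (Suc i, j') \<notin> P" if j: "j = Suc j'" for j'
  proof
    assume "cell (Suc i, j') \<in> P"
    then obtain j1 j2 where m: "maximal_inner_interval P (Suc i, j1) (Suc (Suc i), j2)" "j1 \<le> j'" "Suc j \<le> j2"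
      using maximal_vertical[of "Suc i" j'] C j by auto
    have "j2 = Suc j"
      using maximal_inner_interval_cells[OF m(1), of "Suc i" "Suc j"] U m j by (cases "j2 = Suc j") auto
    then show False
      using maximal_vertical_corners(1)[OF m(1)] D by simp
  qed
  ultimately show ?thesis
    using L by (simp add: lonely_def)
qed

text \<open>The mirror image of \<open>lower_lonely\<close>: now the lower-left cell is missing, so
  the strip through a supposed neighbour starts, rather than ends, at the coordinate of the
  centre.\<close>

lemma upper_lonely:
  assumes D: "cell (i, Suc j) \<in> P" and C: "cell (Suc i, j) \<in> P" and U: "cell (Suc i, Suc j) \<in> P"
  shows "lonely P (Suc i, Suc j)"
proof -
  have L: "cell (i, j) \<notin> P"
    using not_square C D U by blast
  have "cell (i, Suc (Suc j)) \<notin> P"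
  proof
    assume "cell (i, Suc (Suc j)) \<in> P"
    then obtain j1 j2 where m: "maximal_inner_interval P (i, j1) (Suc i, j2)" "j1 \<le> Suc j" "Suc (Suc (Suc j)) \<le> j2"
      using maximal_vertical[of i "Suc j"] D by auto
    have "j1 = Suc j"
      using maximal_inner_interval_cells[OF m(1), of i j] L m by (cases "j1 = Suc j") auto
    then show False
      using maximal_vertical_corners(2)[OF m(1)] C by simp
  qed
  moreover have "cell (Suc (Suc i), j) \<notin> P"
  proof
    assume "cell (Suc (Suc i), j) \<in> P"
    then obtain i1 i2 where m: "maximal_inner_interval P (i1, j) (i2, Suc j)" "i1 \<le> Suc i" "Suc (Suc (Suc i)) \<le> i2"
      using maximal_horizontal[of "Suc i" j] C by auto
    have "i1 = Suc i"
      using maximal_inner_interval_cells[OF m(1), of i j] L m by (cases "i1 = Suc i") auto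
    then show False
      using maximal_horizontal_corners(1)[OF m(1)] D by simp
  qed
  ultimately show ?thesis
    using U by (simp add: lonely_def)
qed

lemma pair_in_ideal:
  fixes I :: "(nat \<times> nat, 'k::field) mvpoly set"
  assumes "ideal I (poly_ring V)" "cell (i, Suc j) \<in> P" "cell (Suc i, j) \<in> P" "block_det V (i, j) \<in> I"
    and "cell (i, j) \<in> P \<and> cell_minor (i, j) \<in> I \<or>
      cell (Suc i, Suc j) \<in> P \<and> cell_minor (Suc i, Suc j) \<in> I"
  shows "cell_minor (i, Suc j) * cell_minor (Suc i, j) \<in> I"
  using assms cell_vertices[OF assms(2)] cell_vertices[OF assms(3)]
    cell_vertices[of i j P] cell_vertices[of "Suc i" "Suc j" P]
  by (intro cell_minor_mult_in_ideal) auto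


section \<open>The Knutson polynomial\<close>

lemma finite_factor_index: "finite (factor_index P)"
proof -
  have "{a. lonely P a} \<subseteq> {a. cell a \<in> P}"
    by (auto simp: lonely_def)
  moreover have "inj_on (\<lambda>(i, j). (i, Suc j)) (blocks P)" "(\<lambda>(i, j). (i, Suc j)) ` blocks P \<subseteq> {a. cell a \<in> P}"
    by (auto simp: inj_on_def blocks_def)
  ultimately show ?thesis
    unfolding factor_index_def using finite_cells by (meson finite_UnI finite_imageI finite_subset inj_on_finite)
qed

lemma factor_index_cases [consumes 1, case_names lonely block]:
  assumes "\<iota> \<in> factor_index P"
  obtains i j where "\<iota> = Inl (i, j)" "lonely P (i, j)" "cell (i, j) \<in> P"
    | i j where "\<iota> = Inr (i, j)" "cell (i, Suc j) \<in> P" "cell (Suc i, j) \<in> P"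
  using assms by (auto simp: factor_index_def blocks_def lonely_def)

lemma carrier_factor: "\<iota> \<in> factor_index P \<Longrightarrow> factor P \<iota> \<in> carrier (poly_ring V)"
  by (cases rule: factor_index_cases) (auto simp: factor_def carrier_cell_minor carrier_block_det)

lemma leads_factor:
  assumes "\<iota> \<in> factor_index P"
  shows "leads distance_weight (factor P \<iota> :: (nat \<times> nat, 'k::field) mvpoly) (indicator_monom (factor_support \<iota>))"
  using assms
proof (cases rule: factor_index_cases)
  case (lonely i j)
  then show ?thesis
    by (simp add: factor_def factor_support_def leads_cell_minor)
next
  case (block i j)
  then show ?thesis
    using cell_vertices[OF block(2)] cell_vertices[OF block(3)]
    by (simp add: factor_def factor_support_def leads_block_det)
qed

text \<open>A common variable is an anti-diagonal vertex of a cell of each factor, so these cells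
  coincide or are anti-diagonal neighbours. This contradicts loneliness if one factor belongs to a
  lonely cell; two different blocks would give three consecutive cells on an anti-diagonal, which
  condition (1) forbids.\<close>

lemma factor_support_disjoint:
  assumes "\<iota> \<in> factor_index P" "\<kappa> \<in> factor_index P" "\<iota> \<noteq> \<kappa>"
  shows "factor_support \<iota> \<inter> factor_support \<kappa> = {}"
  using assms(1)
proof (cases rule: factor_index_cases)
  case \<iota>: (lonely i j)
  show ?thesis
    using assms(2)
  proof (cases rule: factor_index_cases)
    case (lonely i' j')
    then show ?thesis
      using \<iota> assms(3) by (auto simp: factor_support_def lonely_def)
  next
    case (block i' j')
    then show ?thesis
      using \<iota> by (auto simp: factor_support_def lonely_def)
  qed
next
  case \<iota>: (block i j)
  show ?thesis
    using assms(2)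
  proof (cases rule: factor_index_cases)
    case (lonely i' j')
    then show ?thesis
      using \<iota> by (auto simp: factor_support_def lonely_def)
  next
    case (block i' j')
    then show ?thesis
      using \<iota> assms(3) no_three by (auto simp: factor_support_def)
  qed
qed

lemma carrier_knutson_poly: "knutson_poly P \<in> carrier (poly_ring V)"
  unfolding knutson_poly_def by (intro carrier_prod carrier_factor)

lemma has_squarefree_initial_monomial_knutson_poly:
  "has_squarefree_initial_monomial V (knutson_poly P :: (nat \<times> nat, 'k::field) mvpoly)"
proof (rule has_squarefree_initial_monomialI)
  show "leads distance_weight (knutson_poly P :: (nat \<times> nat, 'k) mvpoly)
      (\<Sum>\<iota>\<in>factor_index P. indicator_monom (factor_support \<iota>))"
    unfolding knutson_poly_def by (intro leads_prod leads_factor)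
  show "squarefree_monomial (\<Sum>\<iota>\<in>factor_index P. indicator_monom (factor_support \<iota>))"
    by (intro squarefree_sum_indicator_monom finite_factor_index factor_support_disjoint)
      (auto simp: factor_support_def split: sum.split)
qed (simp_all add: distance_weight_def carrier_knutson_poly)

section \<open>From factors of the Knutson polynomial to ideals of strips\<close>

lemma factor_ideal_in_knutson_class:
  assumes "\<iota> \<in> factor_index P"
  shows "Idl\<^bsub>poly_ring V\<^esub> {factor P \<iota>} \<in> knutson_class (poly_ring V) (knutson_poly P :: (nat \<times> nat, 'k::field) mvpoly)"
proof -
  let ?h = "prod (factor P) (factor_index P - {\<iota>}) :: (nat \<times> nat, 'k) mvpoly"
  have "knutson_poly P = factor P \<iota> * ?h"
    unfolding knutson_poly_def by (rule prod.remove[OF finite_factor_index assms])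
  \<comment> \<open>The complementary product has a leading monomial, hence is nonzero.\<close>
  moreover have "?h \<noteq> 0"
    using leads_prod[of "factor_index P - {\<iota>}" distance_weight "factor P" "\<lambda>\<iota>. indicator_monom (factor_support \<iota>)"]
      leads_factor by (auto dest: leads_nonzero)
  moreover have "?h \<in> carrier (poly_ring V)"
    by (intro carrier_prod carrier_factor) simp
  ultimately show ?thesis
    using knutson_class_factor[OF carrier_factor[OF assms]] by metis
qed

text \<open>The argument common to rows and columns; \<open>c\<close> lists the cells of the strip.
  For a cell that is not lonely, \<open>third\<close> provides a block with its determinant in
  \<open>Q\<close>, a further cell of the strip on the main diagonal of that block, and a vertex of
  the anti-diagonal partner off the strip. Two candidates are offered for a partner at the lower
  right, since a vertical strip contains one of them.\<close>

lemma minors_ideal_in_knutson_class_if_cells: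
  fixes Q :: "(nat \<times> nat, 'k::field) mvpoly set"
  assumes "two_row V C \<pi> z" and C: "C = \<alpha> ` {..n}" and "n > 0"
    and Q: "Q = Idl\<^bsub>poly_ring V\<^esub> (two_row.minors C \<pi>)"
    and minor: "\<And>k. k < n \<Longrightarrow> minor (\<alpha> k) (\<pi> (\<alpha> (Suc k))) (\<alpha> (Suc k)) (\<pi> (\<alpha> k)) = (cell_minor (c k) :: (nat \<times> nat, 'k) mvpoly)"
    and cells: "\<And>k. k < n \<Longrightarrow> cell (c k) \<in> P"
    and third: "\<And>k. k < n \<Longrightarrow> \<not> lonely P (c k) \<Longrightarrow> \<exists>(i, j)\<in>blocks P. block_det V (i, j) \<in> Q \<and>
        ((\<exists>l<n. c l = (i, j)) \<or> (\<exists>l<n. c l = (Suc i, Suc j))) \<and>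
        (c k = (i, Suc j) \<and> \<not> {(Suc i, j), (Suc (Suc i), j)} \<subseteq> C \<union> \<pi> ` C \<or>
         c k = (Suc i, j) \<and> (i, Suc (Suc j)) \<notin> C \<union> \<pi> ` C)"
  shows "Q \<in> knutson_class (poly_ring V) (knutson_poly P)"
proof -
  interpret two_row V C \<pi> z
    by (rule assms(1))
  let ?G = "factor P ` factor_index P \<inter> Q" and ?R = "poly_ring V :: (nat \<times> nat, 'k) mvpoly ring"
  let ?A = "Idl\<^bsub>?R\<^esub> ?G"
  have G: "?G \<subseteq> carrier ?R"
    using carrier_factor by blast
  have A: "ideal ?A ?R"
    by (rule ideal_genideal[OF G])
  have G_A: "g \<in> ?A" if "g \<in> ?G" for g
    using ring.genideal_self[OF ring_poly_ring G] that by blast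
  have cell_Q: "cell_minor (c k) \<in> Q" if "k < n" for k
    unfolding Q minor[OF that, symmetric] using that by (intro minor_in_minors_ideal) (auto simp: C)
  have lonely_G: "cell_minor (c k) \<in> ?G" if "k < n" "lonely P (c k)" for k
    using cell_Q[OF that(1)] that(2) by (force simp: factor_index_def factor_def)
  \<comment> \<open>The same case distinction exhibits an element of \<open>?G\<close>; applied to
    the first cell of the strip, it gives that \<open>?G\<close> is nonempty.\<close>
  have adjacent: "?G \<noteq> {} \<and> (\<exists>w\<in>carrier ?R. rank_one_map w \<noteq> 0 \<and> w * cell_minor (c k) \<in> ?A)" if k: "k < n" for k
  proof (cases "lonely P (c k)")
    case True
    have "(1 :: (nat \<times> nat, 'k) mvpoly) * cell_minor (c k) \<in> ?A"
      using G_A[OF lonely_G[OF k True]] by simp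
    then show ?thesis
      using lonely_G[OF k True] carrier_1 rank_one_map_1 by (metis empty_iff zero_neq_one)
  next
    case False
    obtain i j where D: "cell (i, Suc j) \<in> P" and C': "cell (Suc i, j) \<in> P" and det: "block_det V (i, j) \<in> Q"
      and third': "(\<exists>l<n. c l = (i, j)) \<or> (\<exists>l<n. c l = (Suc i, Suc j))"
      and pos: "c k = (i, Suc j) \<and> \<not> {(Suc i, j), (Suc (Suc i), j)} \<subseteq> C \<union> \<pi> ` C \<or>
         c k = (Suc i, j) \<and> (i, Suc (Suc j)) \<notin> C \<union> \<pi> ` C"
      using third[OF k False] unfolding blocks_def by blast
    have "Inr (i, j) \<in> factor_index P"
      using D C' by (auto simp: factor_index_def blocks_def)
    then have det_G: "block_det V (i, j) \<in> ?G"
      using det by (force simp: factor_def)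
    \<comment> \<open>The third cell is lonely by its position in the block, so its minor is a
      factor of \<open>knutson_poly P\<close> that lies in \<open>Q\<close>.\<close>
    have "cell (i, j) \<in> P \<and> cell_minor (i, j) \<in> ?A \<or>
      cell (Suc i, Suc j) \<in> P \<and> cell_minor (Suc i, Suc j) \<in> ?A"
      using third'
    proof (elim disjE exE conjE)
      fix l assume l: "l < n" "c l = (i, j)"
      then show ?thesis
        using G_A[OF lonely_G[OF l(1)]] lower_lonely[OF D C'] cells[OF l(1)] by simp
    next
      fix l assume l: "l < n" "c l = (Suc i, Suc j)"
      then show ?thesis
        using G_A[OF lonely_G[OF l(1)]] upper_lonely[OF D C'] cells[OF l(1)] by simp
    qed
    then have prod: "cell_minor (i, Suc j) * cell_minor (Suc i, j) \<in> ?A"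
      using pair_in_ideal[OF A D C' G_A[OF det_G]] by blast
    show ?thesis
      using pos
    proof (elim disjE conjE)
      assume "c k = (i, Suc j)" "\<not> {(Suc i, j), (Suc (Suc i), j)} \<subseteq> C \<union> \<pi> ` C"
      moreover from this obtain v where "v \<in> {(Suc i, j), (Suc (Suc i), j)}" "v \<notin> C" "v \<notin> \<pi> ` C"
        by blast
      \<comment> \<open>The multiplier is the minor of the partner cell; \<open>v\<close> is off the
        strip and occurs in exactly one of its terms.\<close>
      then have "rank_one_map (cell_minor (Suc i, j)) \<noteq> (0 :: (nat \<times> nat, 'k) mvpoly)"
        unfolding cell_minor_Pair by (intro rank_one_map_minor_nonzero[of v]) auto
      ultimately show ?thesis
        using prod det_G carrier_cell_minor[OF C'] by (metis empty_iff mult.commute)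
    next
      assume "c k = (Suc i, j)" "(i, Suc (Suc j)) \<notin> C \<union> \<pi> ` C"
      moreover from this have "rank_one_map (cell_minor (i, Suc j)) \<noteq> (0 :: (nat \<times> nat, 'k) mvpoly)"
        unfolding cell_minor_Pair by (intro rank_one_map_minor_nonzero[of "(i, Suc (Suc j))"]) auto
      ultimately show ?thesis
        using prod det_G carrier_cell_minor[OF D] by (metis empty_iff)
    qed
  qed
  have "finite ?G" "?G \<noteq> {}" "?G \<subseteq> minors_ideal"
    using finite_factor_index adjacent[OF \<open>n > 0\<close>] Q by auto
  then show ?thesis
    unfolding Q using factor_ideal_in_knutson_class adjacent minor
    by (intro minors_ideal_in_knutson_class[OF C, of ?G]) (auto simp: Q)
qed

section \<open>Horizontal and vertical strips as two-row matrices\<close>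

lemma interval_entry:
  "inner_interval P (a, b) (c, d) \<Longrightarrow> a \<le> x \<Longrightarrow> x \<le> c \<Longrightarrow> b \<le> y \<Longrightarrow> y \<le> d \<Longrightarrow> (x, y) \<in> V"
  by (rule inner_interval_vertex[of a c b d P]) (auto simp: inner_interval_iff)

definition row_minors :: "nat \<Rightarrow> nat \<Rightarrow> nat \<Rightarrow> (nat \<times> nat, 'k::field) mvpoly set" where
  "row_minors i1 i2 j = two_row.minors ((\<lambda>i. (i, j)) ` {i1..i2}) (\<lambda>v. (fst v, Suc (snd v)))"

definition column_minors :: "nat \<Rightarrow> nat \<Rightarrow> nat \<Rightarrow> (nat \<times> nat, 'k::field) mvpoly set" where
  "column_minors i j1 j2 = two_row.minors (Pair i ` {j1..j2}) (\<lambda>v. (Suc (fst v), snd v))"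

lemma two_row_row:
  assumes "inner_interval P (i1, j) (i2, Suc j)"
  shows "two_row V ((\<lambda>i. (i, j)) ` {i1..i2}) (\<lambda>v. (fst v, Suc (snd v))) (i1, j)"
  using interval_entry[OF assms] assms
  by unfold_locales (auto simp: inj_on_def inner_interval_iff)

lemma two_row_column:
  assumes "inner_interval P (i, j1) (Suc i, j2)"
  shows "two_row V (Pair i ` {j1..j2}) (\<lambda>v. (Suc (fst v), snd v)) (i, j1)"
  using interval_entry[OF assms] assms
  by unfold_locales (auto simp: inj_on_def inner_interval_iff)

lemma row_minors_iff:
  assumes "inner_interval P (i1, j) (i2, Suc j)"
  shows "p \<in> row_minors i1 i2 j \<longleftrightarrow>
    (\<exists>s\<in>{i1..i2}. \<exists>t\<in>{i1..i2}. p = minor (s, j) (t, Suc j) (t, j) (s, Suc j))"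
  unfolding row_minors_def two_row.minors_image_iff[OF two_row_row[OF assms] refl] by simp

lemma column_minors_iff:
  assumes "inner_interval P (i, j1) (Suc i, j2)"
  shows "p \<in> column_minors i j1 j2 \<longleftrightarrow>
    (\<exists>s\<in>{j1..j2}. \<exists>t\<in>{j1..j2}. p = minor (i, s) (Suc i, t) (i, t) (Suc i, s))"
  unfolding column_minors_def two_row.minors_image_iff[OF two_row_column[OF assms] refl] by simp

lemma row_minors_carrier:
  assumes "inner_interval P (i1, j) (i2, Suc j)"
  shows "row_minors i1 i2 j \<subseteq> carrier (poly_ring V)"
  unfolding row_minors_def by (rule two_row.minors_carrier[OF two_row_row[OF assms]])

lemma column_minors_carrier:
  assumes "inner_interval P (i, j1) (Suc i, j2)"
  shows "column_minors i j1 j2 \<subseteq> carrier (poly_ring V)"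
  unfolding column_minors_def by (rule two_row.minors_carrier[OF two_row_column[OF assms]])

lemma row_entry_minor:
  assumes I: "inner_interval P (i1, j) (i2, Suc j)" and "i1 \<le> s" "s \<le> i2" "i1 \<le> t" "t \<le> i2"
  shows "(entry_minor V (s, j) (t, Suc j) (s, Suc j) (t, j) :: (nat \<times> nat, 'k::field) mvpoly) \<in> Idl\<^bsub>poly_ring V\<^esub> (row_minors i1 i2 j)"
proof -
  have "(minor (s, j) (t, Suc j) (s, Suc j) (t, j) :: (nat \<times> nat, 'k) mvpoly) \<in> row_minors i1 i2 j"
    unfolding row_minors_iff[OF I] using assms(2-) minor_swap(2) by (metis atLeastAtMost_iff)
  moreover have "(entry_minor V (s, j) (t, Suc j) (s, Suc j) (t, j) :: (nat \<times> nat, 'k) mvpoly) = minor (s, j) (t, Suc j) (s, Suc j) (t, j)"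
    using assms(2-) by (intro entry_minor_eq_minor interval_entry[OF I]) auto
  ultimately show ?thesis
    using ring.genideal_self[OF ring_poly_ring row_minors_carrier[OF I]] by fastforce
qed

lemma column_entry_minor:
  assumes I: "inner_interval P (i, j1) (Suc i, j2)" and "j1 \<le> s" "s \<le> j2" "j1 \<le> t" "t \<le> j2"
  shows "(entry_minor V (i, s) (Suc i, t) (i, t) (Suc i, s) :: (nat \<times> nat, 'k::field) mvpoly) \<in> Idl\<^bsub>poly_ring V\<^esub> (column_minors i j1 j2)"
proof -
  have "(minor (i, s) (Suc i, t) (i, t) (Suc i, s) :: (nat \<times> nat, 'k) mvpoly) \<in> column_minors i j1 j2"
    unfolding column_minors_iff[OF I] using assms(2-) by (metis atLeastAtMost_iff)
  moreover have "(entry_minor V (i, s) (Suc i, t) (i, t) (Suc i, s) :: (nat \<times> nat, 'k) mvpoly) = minor (i, s) (Suc i, t) (i, t) (Suc i, s)"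
    using assms(2-) by (intro entry_minor_eq_minor interval_entry[OF I]) auto
  ultimately show ?thesis
    using ring.genideal_self[OF ring_poly_ring column_minors_carrier[OF I]] by fastforce
qed

text \<open>If a cell of the strip has an upper-left neighbour, the third cell of their block is the
  previous cell of the strip; for a lower-right neighbour it is the next one. Condition (3)
  guarantees that this cell exists.\<close>

lemma row_minors_in_knutson_class:
  assumes m: "maximal_inner_interval P (i1, j) (i2, Suc j)"
  shows "Idl\<^bsub>poly_ring V\<^esub> (row_minors i1 i2 j) \<in>
    knutson_class (poly_ring V) (knutson_poly P :: (nat \<times> nat, 'k::field) mvpoly)"
proof -
  let ?C = "(\<lambda>i. (i, j)) ` {i1..i2}" and ?\<pi> = "\<lambda>v::nat \<times> nat. (fst v, Suc (snd v))"
  let ?Q = "Idl\<^bsub>poly_ring V\<^esub> (row_minors i1 i2 j) :: (nat \<times> nat, 'k) mvpoly set"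
  note I = maximal_inner_intervalD[OF m]
  have "i1 < i2"
    using I by (simp add: inner_interval_iff)
  have Q: "ideal ?Q (poly_ring V)"
    by (rule ideal_genideal[OF row_minors_carrier[OF I]])
  show ?thesis
  proof (rule minors_ideal_in_knutson_class_if_cells[where c = "\<lambda>k. (i1 + k, j)"])
    show "two_row V ?C ?\<pi> (i1, j)"
      by (rule two_row_row[OF I])
    have "{i1..i2} = (+) i1 ` {..i2 - i1}"
      using \<open>i1 < i2\<close> by (simp add: atMost_atLeast0)
    then show "?C = (\<lambda>k. (i1 + k, j)) ` {..i2 - i1}"
      by (simp add: image_image)
    show "i2 - i1 > 0"
      using \<open>i1 < i2\<close> by simp
    show "?Q = Idl\<^bsub>poly_ring V\<^esub> (two_row.minors ?C ?\<pi>)"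
      by (simp add: row_minors_def)
  next
    fix k
    assume k: "k < i2 - i1"
    show "minor (i1 + k, j) (?\<pi> (i1 + Suc k, j)) (i1 + Suc k, j) (?\<pi> (i1 + k, j)) = cell_minor (i1 + k, j)"
      by (simp add: cell_minor_Pair minor_swap(2))
    show "cell (i1 + k, j) \<in> P"
      using k by (intro maximal_inner_interval_cells[OF m]) auto
    assume "\<not> lonely P (i1 + k, j)"
    then consider i where "i1 + k = Suc i" "cell (i, Suc j) \<in> P"
      | j' where "j = Suc j'" "cell (Suc (i1 + k), j') \<in> P"
      using \<open>cell (i1 + k, j) \<in> P\<close> by (auto simp: lonely_def)
    then show "\<exists>(i, j')\<in>blocks P. block_det V (i, j') \<in> ?Q \<and>
        ((\<exists>l<i2 - i1. (i1 + l, j) = (i, j')) \<or> (\<exists>l<i2 - i1. (i1 + l, j) = (Suc i, Suc j'))) \<and>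
        ((i1 + k, j) = (i, Suc j') \<and> \<not> {(Suc i, j'), (Suc (Suc i), j')} \<subseteq> ?C \<union> ?\<pi> ` ?C \<or>
         (i1 + k, j) = (Suc i, j') \<and> (i, Suc (Suc j')) \<notin> ?C \<union> ?\<pi> ` ?C)"
    proof cases
      case 1
      \<comment> \<open>The upper-left neighbour of the first cell would have its lower-right vertex
        at the upper-left corner of the strip.\<close>
      have "k \<noteq> 0"
        using maximal_horizontal_corners(1)[OF m, of i] 1 by (cases k) auto
      then have "i1 \<le> i" "Suc (Suc i) \<le> i2"
        using 1(1) k by auto
      then have "block_det V (i, j) \<in> ?Q"
        by (intro block_det_in_ideal_rows[OF Q, of j] row_entry_minor[OF I]) auto
      moreover have "k - 1 < i2 - i1" "(i1 + (k - 1), j) = (i, j)"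
        using \<open>k \<noteq> 0\<close> k 1(1) by auto
      ultimately show ?thesis
        using 1 \<open>cell (i1 + k, j) \<in> P\<close> by (intro bexI[of _ "(i, j)"]) (auto simp: blocks_def)
    next
      case 2
      let ?i = "i1 + k"
      \<comment> \<open>The lower-right neighbour of the last cell would have its upper-left vertex
        at the lower-right corner of the strip.\<close>
      have "Suc ?i \<noteq> i2"
        using maximal_horizontal_corners(2)[OF m, of j'] 2 by auto
      then have "Suc (Suc ?i) \<le> i2"
        using k by auto
      then have "block_det V (?i, j') \<in> ?Q"
        by (intro block_det_in_ideal_rows[OF Q, of j] row_entry_minor[OF I]) (use 2(1) in auto)
      moreover have "Suc k < i2 - i1" "(i1 + Suc k, j) = (Suc ?i, Suc j')"
        using \<open>Suc (Suc ?i) \<le> i2\<close> 2(1) by auto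
      ultimately show ?thesis
        using 2 \<open>cell (i1 + k, j) \<in> P\<close> by (intro bexI[of _ "(?i, j')"]) (auto simp: blocks_def)
    qed
  qed
qed

text \<open>As for rows, with condition (2) and the roles exchanged: an upper-left neighbour calls
  for the next cell upwards, a lower-right neighbour for the previous one.\<close>

lemma column_minors_in_knutson_class:
  assumes m: "maximal_inner_interval P (i, j1) (Suc i, j2)"
  shows "Idl\<^bsub>poly_ring V\<^esub> (column_minors i j1 j2) \<in>
    knutson_class (poly_ring V) (knutson_poly P :: (nat \<times> nat, 'k::field) mvpoly)"
proof -
  let ?C = "Pair i ` {j1..j2}" and ?\<pi> = "\<lambda>v::nat \<times> nat. (Suc (fst v), snd v)"
  let ?Q = "Idl\<^bsub>poly_ring V\<^esub> (column_minors i j1 j2) :: (nat \<times> nat, 'k) mvpoly set"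
  note I = maximal_inner_intervalD[OF m]
  have "j1 < j2"
    using I by (simp add: inner_interval_iff)
  have Q: "ideal ?Q (poly_ring V)"
    by (rule ideal_genideal[OF column_minors_carrier[OF I]])
  show ?thesis
  proof (rule minors_ideal_in_knutson_class_if_cells[where c = "\<lambda>k. (i, j1 + k)"])
    show "two_row V ?C ?\<pi> (i, j1)"
      by (rule two_row_column[OF I])
    have "{j1..j2} = (+) j1 ` {..j2 - j1}"
      using \<open>j1 < j2\<close> by (simp add: atMost_atLeast0)
    then show "?C = (\<lambda>k. (i, j1 + k)) ` {..j2 - j1}"
      by (simp add: image_image)
    show "j2 - j1 > 0"
      using \<open>j1 < j2\<close> by simp
    show "?Q = Idl\<^bsub>poly_ring V\<^esub> (two_row.minors ?C ?\<pi>)"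
      by (simp add: column_minors_def)
  next
    fix k
    assume k: "k < j2 - j1"
    show "minor (i, j1 + k) (?\<pi> (i, j1 + Suc k)) (i, j1 + Suc k) (?\<pi> (i, j1 + k)) = cell_minor (i, j1 + k)"
      by (simp add: cell_minor_Pair)
    show "cell (i, j1 + k) \<in> P"
      using k by (intro maximal_inner_interval_cells[OF m]) auto
    assume "\<not> lonely P (i, j1 + k)"
    then consider i' where "i = Suc i'" "cell (i', Suc (j1 + k)) \<in> P"
      | j where "j1 + k = Suc j" "cell (Suc i, j) \<in> P"
      using \<open>cell (i, j1 + k) \<in> P\<close> by (auto simp: lonely_def)
    then show "\<exists>(i', j)\<in>blocks P. block_det V (i', j) \<in> ?Q \<and>
        ((\<exists>l<j2 - j1. (i, j1 + l) = (i', j)) \<or> (\<exists>l<j2 - j1. (i, j1 + l) = (Suc i', Suc j))) \<and>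
        ((i, j1 + k) = (i', Suc j) \<and> \<not> {(Suc i', j), (Suc (Suc i'), j)} \<subseteq> ?C \<union> ?\<pi> ` ?C \<or>
         (i, j1 + k) = (Suc i', j) \<and> (i', Suc (Suc j)) \<notin> ?C \<union> ?\<pi> ` ?C)"
    proof cases
      case 1
      let ?j = "j1 + k"
      have "Suc ?j \<noteq> j2"
        using maximal_vertical_corners(1)[OF m, of i'] 1 by auto
      then have "Suc (Suc ?j) \<le> j2"
        using k by auto
      then have "block_det V (i', ?j) \<in> ?Q"
        by (intro block_det_in_ideal_columns[OF Q, of i] column_entry_minor[OF I]) (use 1(1) in auto)
      moreover have "Suc k < j2 - j1" "(i, j1 + Suc k) = (Suc i', Suc ?j)"
        using \<open>Suc (Suc ?j) \<le> j2\<close> 1(1) by auto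
      ultimately show ?thesis
        using 1 \<open>cell (i, j1 + k) \<in> P\<close> by (intro bexI[of _ "(i', ?j)"]) (auto simp: blocks_def)
    next
      case 2
      have "k \<noteq> 0"
        using maximal_vertical_corners(2)[OF m, of j] 2 by (cases k) auto
      then have "j1 \<le> j" "Suc (Suc j) \<le> j2"
        using 2(1) k by auto
      then have "block_det V (i, j) \<in> ?Q"
        by (intro block_det_in_ideal_columns[OF Q, of i] column_entry_minor[OF I]) auto
      moreover have "\<exists>l<j2 - j1. j1 + l = j"
        using \<open>k \<noteq> 0\<close> k 2(1) by (intro exI[of _ "k - 1"]) auto
      ultimately show ?thesis
        using 2 \<open>cell (i, j1 + k) \<in> P\<close> by (intro bexI[of _ "(i, j)"]) (auto simp: blocks_def)
    qed
  qed
qed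

section \<open>The polyomino ideal as the sum of the ideals of its maximal strips\<close>

definition strip_minors :: "nat \<times> nat \<Rightarrow> nat \<times> nat \<Rightarrow> (nat \<times> nat, 'k::field) mvpoly set" where
  "strip_minors a b = (if snd b = Suc (snd a) then row_minors (fst a) (fst b) (snd a)
     else column_minors (fst a) (snd a) (snd b))"

definition interval_minors :: "(nat \<times> nat, 'k::field) mvpoly set" where
  "interval_minors = {mvar a * mvar b - mvar (upper_left a b) * mvar (lower_right a b) | a b. inner_interval P a b}"

lemma polyomino_ideal_eq: "polyomino_ideal P = Idl\<^bsub>poly_ring V\<^esub> interval_minors"
  by (simp add: polyomino_ideal_def interval_minors_def)

lemma interval_minors_iff:
  "p \<in> interval_minors \<longleftrightarrow> (\<exists>a b c d. inner_interval P (a, b) (c, d) \<and> p = minor (a, b) (c, d) (a, d) (c, b))"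
  by (auto simp: interval_minors_def minor_def upper_left_def lower_right_def)

lemma interval_minors_carrier: "interval_minors \<subseteq> carrier (poly_ring V)"
proof
  fix p
  assume "p \<in> interval_minors"
  then obtain a b c d where I: "inner_interval P (a, b) (c, d)" and p: "p = minor (a, b) (c, d) (a, d) (c, b)"
    unfolding interval_minors_iff by blast
  have "a < c" "b < d"
    using I by (simp_all add: inner_interval_iff)
  then show "p \<in> carrier (poly_ring V)"
    unfolding p by (intro carrier_minor interval_entry[OF I]) auto
qed

lemma strip_cases [consumes 1, case_names row column]:
  assumes "maximal_inner_interval P a b"
  obtains i1 i2 j where "a = (i1, j)" "b = (i2, Suc j)" "inner_interval P (i1, j) (i2, Suc j)"
      "strip_minors a b = (row_minors i1 i2 j :: (nat \<times> nat, 'k::field) mvpoly set)"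
    | i j1 j2 where "a = (i, j1)" "b = (Suc i, j2)" "inner_interval P (i, j1) (Suc i, j2)"
      "strip_minors a b = (column_minors i j1 j2 :: (nat \<times> nat, 'k::field) mvpoly set)"
proof -
  obtain a1 a2 b1 b2 where ab: "a = (a1, a2)" "b = (b1, b2)"
    by (cases a, cases b)
  have I: "inner_interval P (a1, a2) (b1, b2)"
    using maximal_inner_intervalD[OF assms] ab by simp
  \<comment> \<open>A single cell is both a row and a column; it is counted as a row, in agreement
    with \<open>strip_minors\<close>.\<close>
  then have "b2 = Suc a2 \<or> b2 \<noteq> Suc a2 \<and> b1 = Suc a1"
    using inner_interval_strip by blast
  then show ?thesis
    using that ab I by (auto simp: strip_minors_def)
qed

text \<open>Every subinterval of a strip is inner. The minors of a strip run over ordered pairs of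
  indices, so besides the generators they include their negatives and \<open>0\<close>.\<close>

lemma strip_minors_in_polyomino_ideal:
  assumes "maximal_inner_interval P a b"
  shows "(strip_minors a b :: (nat \<times> nat, 'k::field) mvpoly set) \<subseteq> Idl\<^bsub>poly_ring V\<^esub> interval_minors"
proof
  fix p :: "(nat \<times> nat, 'k) mvpoly"
  let ?I = "Idl\<^bsub>poly_ring V\<^esub> interval_minors :: (nat \<times> nat, 'k) mvpoly set"
  assume p: "p \<in> strip_minors a b"
  have I: "ideal ?I (poly_ring V)"
    by (rule ideal_genideal[OF interval_minors_carrier])
  have gen: "minor (x, y) (x', y') (x, y') (x', y) \<in> ?I" if "inner_interval P (x, y) (x', y')" for x y x' y'
    using ring.genideal_self[OF ring_poly_ring interval_minors_carrier] that interval_minors_iff by blast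
  have neg: "(minor u v u' v' :: (nat \<times> nat, 'k) mvpoly) = - minor u' v' u v" for u v u' v'
    by (simp add: minor_def)
  from assms show "p \<in> ?I"
  proof (cases rule: strip_cases[where 'k = 'k])
    case (row i1 i2 j)
    then obtain s t where st: "s \<in> {i1..i2}" "t \<in> {i1..i2}" and p: "p = minor (s, j) (t, Suc j) (t, j) (s, Suc j)"
      using p row_minors_iff[OF row(3), of p] by auto
    have sub: "inner_interval P (x, j) (y, Suc j)" if "x < y" "x \<in> {i1..i2}" "y \<in> {i1..i2}" for x y
      using row(3) that by (auto simp: inner_interval_iff)
    consider "s < t" | "s = t" | "t < s"
      by linarith
    then show ?thesis
    proof cases
      case 1
      then show ?thesis
        using gen[OF sub[of s t]] st p by (simp add: minor_swap(2))
    next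
      case 2
      then show ?thesis
        using ideal_0[OF I] by (simp add: p minor_def)
    next
      case 3
      have "p = - minor (t, j) (s, Suc j) (t, Suc j) (s, j)"
        unfolding p by (subst neg) (simp add: minor_swap(2))
      then show ?thesis
        using ideal_uminus[OF I gen[OF sub[of t s]]] st 3 by simp
    qed
  next
    case (column i j1 j2)
    then obtain s t where st: "s \<in> {j1..j2}" "t \<in> {j1..j2}" and p: "p = minor (i, s) (Suc i, t) (i, t) (Suc i, s)"
      using p column_minors_iff[OF column(3), of p] by auto
    have sub: "inner_interval P (i, x) (Suc i, y)" if "x < y" "x \<in> {j1..j2}" "y \<in> {j1..j2}" for x y
      using column(3) that by (auto simp: inner_interval_iff)
    consider "s < t" | "s = t" | "t < s"
      by linarith
    then show ?thesis
    proof cases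
      case 1
      then show ?thesis
        using gen[OF sub[of s t]] st p by simp
    next
      case 2
      then show ?thesis
        using ideal_0[OF I] by (simp add: p minor_def)
    next
      case 3
      have "p = - minor (i, t) (Suc i, s) (i, s) (Suc i, t)"
        unfolding p by (rule neg)
      then show ?thesis
        using ideal_uminus[OF I gen[OF sub[of t s]]] st 3 by simp
    qed
  qed
qed

text \<open>The inner interval of the generator extends to a maximal one, which is a strip, and
  spans its full width.\<close>

lemma interval_minors_in_strip_minors:
  assumes "p \<in> interval_minors"
  obtains a b where "maximal_inner_interval P a b" "p \<in> strip_minors a b"
proof -
  obtain x y x' y' where xy: "inner_interval P (x, y) (x', y')" and p: "p = minor (x, y) (x', y') (x, y') (x', y)"
    using assms unfolding interval_minors_iff by blast
  have lt: "x < x'" "y < y'"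
    using xy by (simp_all add: inner_interval_iff)
  from xy obtain a b c d where m: "maximal_inner_interval P (a, b) (c, d)" "a \<le> x" "b \<le> y" "x' \<le> c" "y' \<le> d"
    by (rule maximal_inner_interval_exists)
  from m(1) have "p \<in> strip_minors (a, b) (c, d)"
  proof (cases rule: strip_cases[where 'k = 'a])
    case (row i1 i2 j)
    have "y = j" "y' = Suc j" "x \<in> {i1..i2}" "x' \<in> {i1..i2}"
      using row(1,2) m(2-) lt by auto
    then show ?thesis
      unfolding row(4) row_minors_iff[OF row(3)] p using minor_swap(2) by metis
  next
    case (column i j1 j2)
    have "x = i" "x' = Suc i" "y \<in> {j1..j2}" "y' \<in> {j1..j2}"
      using column(1,2) m(2-) lt by auto
    then show ?thesis
      unfolding column(4) column_minors_iff[OF column(3)] p by metis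
  qed
  then show ?thesis
    using that m(1) by blast
qed

lemma polyomino_ideal_in_knutson_class:
  "polyomino_ideal P \<in> knutson_class (poly_ring V) (knutson_poly P :: (nat \<times> nat, 'k::field) mvpoly)"
proof -
  let ?max = "{(a, b). maximal_inner_interval P a b}"
  let ?M = "(\<lambda>(a, b). strip_minors a b) ` ?max :: (nat \<times> nat, 'k) mvpoly set set"
  have "?max \<subseteq> V \<times> V"
    by (auto simp: maximal_inner_interval_def inner_interval_def)
  then have "finite ?M"
    using finite_V by (intro finite_imageI) (rule finite_subset, auto)
  moreover have "?M \<noteq> {}"
  proof -
    obtain i j where "cell (i, j) \<in> P"
      using collection by (fastforce simp: cell_collection_def)
    then have "inner_interval P (i, j) (Suc i, Suc j)"
      by (simp add: inner_interval_iff less_Suc_eq_le flip: eq_iff)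
    then show ?thesis
      by (rule maximal_inner_interval_exists) blast
  qed
  moreover have carrier: "S \<subseteq> carrier (poly_ring V)" if "S \<in> ?M" for S
  proof -
    have "ideal (Idl\<^bsub>poly_ring V\<^esub> interval_minors) (poly_ring V :: (nat \<times> nat, 'k) mvpoly ring)"
      by (rule ideal_genideal[OF interval_minors_carrier])
    then show ?thesis
      using that strip_minors_in_polyomino_ideal ideal_carrier by blast
  qed
  moreover have "Idl\<^bsub>poly_ring V\<^esub> S \<in> knutson_class (poly_ring V) (knutson_poly P)" if S: "S \<in> ?M" for S
  proof -
    obtain a b where ab: "maximal_inner_interval P a b" "S = strip_minors a b"
      using S by blast
    from ab(1) show ?thesis
      unfolding ab(2)
      by (cases rule: strip_cases[where 'k = 'k])
        (use ab(1) row_minors_in_knutson_class column_minors_in_knutson_class in auto)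
  qed
  ultimately have "Idl\<^bsub>poly_ring V\<^esub> (\<Union>?M) \<in> knutson_class (poly_ring V) (knutson_poly P)"
    by (rule knutson_class_genideal_Union)
  moreover have "Idl\<^bsub>poly_ring V\<^esub> (\<Union>?M) = polyomino_ideal P"
    unfolding polyomino_ideal_eq
  proof
    have M: "\<Union>?M \<subseteq> carrier (poly_ring V)"
      using carrier by blast
    show "Idl\<^bsub>poly_ring V\<^esub> (\<Union>?M) \<subseteq> Idl\<^bsub>poly_ring V\<^esub> interval_minors"
      unfolding genideal_le_iff[OF M ideal_genideal[OF interval_minors_carrier]]
      using strip_minors_in_polyomino_ideal by blast
    have "interval_minors \<subseteq> \<Union>?M"
      by (auto elim!: interval_minors_in_strip_minors)
    then show "Idl\<^bsub>poly_ring V\<^esub> interval_minors \<subseteq> Idl\<^bsub>poly_ring V\<^esub> (\<Union>?M)"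
      unfolding genideal_le_iff[OF interval_minors_carrier ideal_genideal[OF M]]
      using ring.genideal_self[OF ring_poly_ring M] by blast
  qed
  ultimately show ?thesis
    by simp
qed

end

theorem theorem5p1:
  fixes P :: "(nat \<times> nat) set set"
  assumes "cell_collection P" and "thin P"
    and "\<not> (\<exists>i j. has_cell_upper_left P (i, j) \<and> has_cell_upper_left P (i + 1, j - 1) \<and>
                has_cell_upper_left P (i + 2, j - 2))"
    and "\<And>i1 j1 j2. j1 < j2 \<Longrightarrow> maximal_inner_interval P (i1, j1) (i1 + 1, j2) \<Longrightarrow>
           \<not> has_cell_lower_right P (i1, j2) \<and> \<not> has_cell_upper_left P (i1 + 1, j1)"
    and "\<And>i1 i2 j1. i1 < i2 \<Longrightarrow> maximal_inner_interval P (i1, j1) (i2, j1 + 1) \<Longrightarrow>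
           \<not> has_cell_lower_right P (i1, j1 + 1) \<and> \<not> has_cell_upper_left P (i2, j1)"
  shows "\<exists>f \<in> carrier (poly_ring (vertex_set P) :: (nat \<times> nat, 'k::field) mvpoly ring).
           has_squarefree_initial_monomial (vertex_set P) f \<and>
           polyomino_ideal P \<in> knutson_class (poly_ring (vertex_set P)) f"
proof -
  interpret admissible_collection P
    by unfold_locales (rule assms; assumption)+
  show ?thesis
    using carrier_knutson_poly has_squarefree_initial_monomial_knutson_poly
      polyomino_ideal_in_knutson_class by blast
qed

end
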